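(* Let $g:\mathbb{R}^m\to\mathbb{R}^l$ be twice continuously differentiable, let $\Theta\subset\mathbb{R}^l$ be a closed convex cone, let $\Gamma:=g^{-1}(\Theta)$, let $\bar y\in\Gamma$, and suppose that the standing assumptions (A1), (A2), (A3) given in the context hold at $\bar y$. Let $\bar w\in\widehat N_\Gamma(\bar y)$, and let $\bar\nu\in\mathbb{R}^l$ be the unique multiplier satisfying the KKT system $$\bar u=\bar y+(\nabla g(\bar y))^T\bar\nu,\qquad 0\in -g(\bar y)+N_{\Theta^*}(\bar\nu)$$ with $\bar u$ given by $\bar w=\bar u-\bar y$. Suppose in addition that $\Theta$ satisfies the projection derivation condition (PDC) at $\bar z=g(\bar y)$. Then for any $v\in\mathbb{R}^m$ we have $$D\widehat N_\Gamma(\bar y,\bar w)(v)=\Big(\sum_{i=1}^l\bar\nu_i\nabla^2g_i(\bar y)\Big)v+(\nabla g(\bar y))^TN_{\overline{\mathcal K}}\big(\nabla g(\bar y)v\big),$$ where $\overline{\mathcal K}:=\mathcal{K}(g(\bar y),\bar\nu)=T_\Theta(g(\bar y))\cap\{\bar\nu\}^\perp$.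
   Context: Notation: $\nabla g(y)$ is the Jacobian of $g$ at $y$; $P_\Omega$ is the Euclidean metric projection onto a closed set $\Omega$; $f'(x;h)$ is the classical directional derivative. $\Theta^*:=\{w\mid\langle w,z\rangle\le 0\ \forall z\in\Theta\}$ is the polar cone. For convex sets $C$, $N_C(z)$ is the normal cone of convex analysis, with $N_C(z)=\emptyset$ for $z\notin C$ (so the right-hand side of the formula is empty if $\nabla g(\bar y)v\notin\overline{\mathcal K}$). Tangent cone: $T_\Omega(\bar z):=\{z\mid\exists\,t_k\downarrow0,\ z_k\to z\text{ with }\bar z+t_kz_k\in\Omega\}$. Regular normal cone: $\widehat N_\Omega(y):=\{v\mid\limsup_{u\to y,\,u\in\Omega}\langle v,u-y\rangle/\|u-y\|\le0\}$ for $y\in\Omega$, and $\widehat N_\Omega(y)=\emptyset$ for $y\notin\Omega$. Graphical derivative of $F:\mathbb{R}^n\rightrightarrows\mathbb{R}^m$ at $(\bar x,\bar y)\in\operatorname{gph}F$: $DF(\bar x,\bar y)(u):=\{v\mid(u,v)\in T_{\operatorname{gph}F}(\bar x,\bar y)\}$. Here $D\widehat N_\Gamma(\bar y,\bar w)$ is the graphical derivative of the mapping $y\mapsto\widehat N_\Gamma(y)$. Critical cone: $\mathcal{K}(\bar z,b):=T_\Theta(\bar z)\cap\{b\}^\perp$. Projection derivation condition (PDC) of $\Theta$ at $\bar z\in\Theta$: $P'_\Theta(\bar z+b;h)=P_{\mathcal{K}(\bar z,b)}(h)$ for all $b\in N_\Theta(\bar z)$ and all $h\in\mathbb{R}^l$.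 Standing assumptions, with $\bar z:=g(\bar y)$: (A1) $\Theta$ is $\mathcal{C}^2$-reducible at $\bar z$ to a closed convex set $\Xi\subset\mathbb{R}^q$, and the reduction is pointed: there exist a neighborhood $V$ of $\bar z$ and a $\mathcal{C}^2$-smooth mapping $\eta:V\to\mathbb{R}^q$ such that for all $z\in V$ one has $z\in\Theta$ if and only if $\eta(z)\in\Xi$, the cone $T_\Xi(\eta(\bar z))$ is pointed, $\eta(\bar z)=0$, and $\nabla\eta(\bar z):\mathbb{R}^l\to\mathbb{R}^q$ is surjective. (A2) $\bar y$ is nondegenerate for $g$ with respect to $\Theta$: $\nabla g(\bar y)\mathbb{R}^m+\operatorname{lin}(T_\Theta(\bar z))=\mathbb{R}^l$, where $\operatorname{lin}(Q)$ denotes the largest linear subspace contained in $Q$. (A3) The metric projection $P_\Theta$ is directionally differentiable on $\mathbb{R}^l$. *)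

theory Defs
  imports "HOL-Analysis.Analysis"
begin

definition C2_smooth_on :: "'a::euclidean_space set \<Rightarrow> ('a \<Rightarrow> 'b::euclidean_space) \<Rightarrow> bool" where
  "C2_smooth_on S f \<longleftrightarrow> open S \<and>
     (\<exists>(f' :: 'a \<Rightarrow> 'a \<Rightarrow>\<^sub>L 'b) (f'' :: 'a \<Rightarrow> 'a \<Rightarrow>\<^sub>L 'a \<Rightarrow>\<^sub>L 'b).
        (\<forall>x\<in>S. (f has_derivative blinfun_apply (f' x)) (at x)) \<and>
        (\<forall>x\<in>S. (f' has_derivative blinfun_apply (f'' x)) (at x)) \<and>
        continuous_on S f'')"

definition gradient :: "(real^'m \<Rightarrow> real) \<Rightarrow> real^'m \<Rightarrow> real^'m" where
  "gradient f y = (\<chi> j. frechet_derivative f (at y) (axis j 1))"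

definition hessian :: "(real^'m \<Rightarrow> real) \<Rightarrow> real^'m \<Rightarrow> real^'m^'m" where
  "hessian f y = jacobian (gradient f) (at y)"

definition tangent_cone :: "'a::real_normed_vector set \<Rightarrow> 'a \<Rightarrow> 'a set" where
  "tangent_cone \<Omega> z = {d. \<exists>(t :: nat \<Rightarrow> real) (d' :: nat \<Rightarrow> 'a).
      (\<forall>k. t k > 0) \<and> t \<longlonglongrightarrow> 0 \<and> d' \<longlonglongrightarrow> d \<and> (\<forall>k. z + t k *\<^sub>R d' k \<in> \<Omega>)}"

text \<open>
  The filter \<open>at y within \<Omega>\<close> excludes the point \<open>y\<close> itself; at an isolated
  point of \<open>\<Omega>\<close> the upper limit is \<open>-\<infinity>\<close>, so every vector is a regular normal.
\<close>

definition regular_normal_cone :: "'a::real_inner set \<Rightarrow> 'a \<Rightarrow> 'a set" where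
  "regular_normal_cone \<Omega> y =
     (if y \<in> \<Omega>
      then {v. Limsup (at y within \<Omega>) (\<lambda>u. ereal (v \<bullet> (u - y) / norm (u - y))) \<le> 0}
      else {})"

definition graphical_derivative ::
  "('a::real_normed_vector \<Rightarrow> 'b::real_normed_vector set) \<Rightarrow> 'a \<Rightarrow> 'b \<Rightarrow> 'a \<Rightarrow> 'b set" where
  "graphical_derivative F x y u = {v. (u, v) \<in> tangent_cone {(x', y'). y' \<in> F x'} (x, y)}"

definition normal_cone :: "'a::real_inner set \<Rightarrow> 'a \<Rightarrow> 'a set" where
  "normal_cone C z = (if z \<in> C then {w. \<forall>c\<in>C. w \<bullet> (c - z) \<le> 0} else {})"

definition polar_cone :: "'a::real_inner set \<Rightarrow> 'a set" where
  "polar_cone \<Theta> = {w. \<forall>z\<in>\<Theta>. w \<bullet> z \<le> 0}"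

definition lin :: "'a::real_vector set \<Rightarrow> 'a set" where
  "lin Q = (GREATEST L. subspace L \<and> L \<subseteq> Q)"

definition pointed :: "'a::real_vector set \<Rightarrow> bool" where
  "pointed C \<longleftrightarrow> C \<inter> uminus ` C = {0}"

definition critical_cone :: "'a::real_inner set \<Rightarrow> 'a \<Rightarrow> 'a \<Rightarrow> 'a set" where
  "critical_cone \<Theta> z b = tangent_cone \<Theta> z \<inter> orthogonal_comp {b}"

definition has_dir_derivative ::
  "('a::real_normed_vector \<Rightarrow> 'b::real_normed_vector) \<Rightarrow> 'a \<Rightarrow> 'a \<Rightarrow> 'b \<Rightarrow> bool" where
  "has_dir_derivative f x h d \<longleftrightarrow>
     ((\<lambda>t. (f (x + t *\<^sub>R h) - f x) /\<^sub>R t) \<longlongrightarrow> d) (at_right 0)"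

definition dir_differentiable ::
  "('a::real_normed_vector \<Rightarrow> 'b::real_normed_vector) \<Rightarrow> bool" where
  "dir_differentiable f \<longleftrightarrow> (\<forall>x h. \<exists>d. has_dir_derivative f x h d)"

text \<open>The projection derivation condition. The metric projection is \<^const>\<open>closest_point\<close>.\<close>

definition PDC :: "'a::euclidean_space set \<Rightarrow> 'a \<Rightarrow> bool" where
  "PDC \<Theta> z \<longleftrightarrow>
     (\<forall>b \<in> normal_cone \<Theta> z. \<forall>h.
        has_dir_derivative (closest_point \<Theta>) (z + b) h (closest_point (critical_cone \<Theta> z b) h))"

text \<open>
  Pointed \<open>C\<^sup>2\<close>-reducibility of \<open>\<Theta>\<close> at \<open>z\<close> to \<open>\<Xi>\<close>. The target space of the reduction
  map is a linear subspace \<open>E\<close> of \<open>real^'q\<close>. Taking \<open>E = UNIV\<close> gives the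
  usual definition with \<open>q = CARD('q)\<close>. The subspace is there because index types are
  nonempty: \<open>E = {0}\<close> is the case \<open>q = 0\<close>, which occurs exactly when \<open>z\<close> is an interior
  point of \<open>\<Theta>\<close>.
\<close>

definition C2_reducible_pointed ::
  "(real^'l) set \<Rightarrow> real^'l \<Rightarrow> (real^'q) set \<Rightarrow> (real^'q) set \<Rightarrow> bool" where
  "C2_reducible_pointed \<Theta> z E \<Xi> \<longleftrightarrow>
     subspace E \<and> \<Xi> \<subseteq> E \<and> closed \<Xi> \<and> convex \<Xi> \<and>
     (\<exists>(V :: (real^'l) set) (\<eta> :: real^'l \<Rightarrow> real^'q).
        z \<in> V \<and> C2_smooth_on V \<eta> \<and> \<eta> ` V \<subseteq> E \<and>
        (\<forall>x\<in>V. x \<in> \<Theta> \<longleftrightarrow> \<eta> x \<in> \<Xi>) \<and>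
        pointed (tangent_cone \<Xi> (\<eta> z)) \<and>
        \<eta> z = 0 \<and>
        range (\<lambda>h. jacobian \<eta> (at z) *v h) = E)"

definition nondegenerate :: "(real^'m \<Rightarrow> real^'l) \<Rightarrow> (real^'l) set \<Rightarrow> real^'m \<Rightarrow> bool" where
  "nondegenerate g \<Theta> y \<longleftrightarrow>
     {a + b | a b. a \<in> range (\<lambda>h. jacobian g (at y) *v h) \<and> b \<in> lin (tangent_cone \<Theta> (g y))} = UNIV"

definition KKT ::
  "(real^'m \<Rightarrow> real^'l) \<Rightarrow> (real^'l) set \<Rightarrow> real^'m \<Rightarrow> real^'m \<Rightarrow> real^'l \<Rightarrow> bool" where
  "KKT g \<Theta> y u \<nu> \<longleftrightarrow>
     u = y + transpose (jacobian g (at y)) *v \<nu> \<and>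
     0 \<in> (\<lambda>n. - g y + n) ` normal_cone (polar_cone \<Theta>) \<nu>"

end

theory Submission
  imports Defs
begin

text \<open>
  Near the reference point \<open>y\<close> the feasible set \<open>\<Gamma>\<close> is the preimage of the convex set \<open>\<Xi>\<close> under
  \<open>F = \<eta> \<circ> g\<close>, where \<open>\<eta>\<close> is the reduction map. Pointedness and nondegeneracy together say that the
  derivative of \<open>F\<close> at \<open>y\<close> maps onto the subspace \<open>E\<close> that contains \<open>\<Xi>\<close>
  (\<open>range_reduction_derivative\<close>). Surjectivity persists at nearby points \<open>x\<close>, and there the regular
  normals to \<open>\<Gamma>\<close> are exactly the vectors \<open>adjoint (F' x) \<mu>\<close> with \<open>\<mu>\<close> in \<open>E\<close> normal to \<open>\<Xi>\<close> at \<open>F x\<close>;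
  the same statement for \<open>\<eta>\<close> describes the normals to \<open>\<Theta>\<close> near \<open>g y\<close>
  (\<open>regular_normal_cone_reduction\<close>). The nontrivial inclusion rests on lifting curves through a map
  with surjective derivative (\<open>solve_along_direction\<close>), which follows from the fixed point theorem of
  Brouwer. As the adjoint of the derivative is injective on \<open>E\<close>, multipliers are unique.

  The graph of the normal cone mapping of \<open>\<Theta>\<close> consists of the pairs \<open>(z, \<nu>)\<close> for which \<open>z\<close> is the
  projection of \<open>z + \<nu>\<close> onto \<open>\<Theta>\<close>. By the projection derivation condition, velocities \<open>(a, n)\<close> of
  such pairs at \<open>(g y, \<nu>)\<close> are therefore those for which \<open>a\<close> is the projection of \<open>a + n\<close> onto the
  critical cone, that is, \<open>n\<close> is normal to the critical cone at \<open>a\<close>. A normal to \<open>\<Gamma>\<close> at \<open>x\<close> has the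
  form \<open>adjoint (g' x) \<nu>\<close>, and the product rule turns velocities \<open>v\<close> of \<open>x\<close> and \<open>n\<close> of \<open>\<nu>\<close> into
  the velocity \<open>adjoint (g'' v) \<nu> + adjoint (g' y) n\<close>, whose first summand is the Hessian term. The two
  inclusions are \<open>graphical_derivative_subset\<close>, where the velocity of \<open>\<nu>\<close> is recovered from the
  normals by a left inverse of the adjoint, and \<open>graphical_derivative_superset\<close>, where a curve of
  projections in \<open>\<Theta>\<close> is lifted to \<open>\<Gamma>\<close>.
\<close>

section \<open>Adjoints of bounded linear maps\<close>

lemma linear_blinfun_apply: "linear (blinfun_apply A)"
  by (simp add: blinfun.bounded_linear_right bounded_linear.linear)

lemma inner_adjoint_blinfun:
  fixes A :: "'a::euclidean_space \<Rightarrow>\<^sub>L 'b::euclidean_space"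
  shows "x \<bullet> adjoint A y = A x \<bullet> y"
  by (rule adjoint_works[OF linear_blinfun_apply])

lemma adjoint_blinfun_expansion:
  fixes A :: "'a::euclidean_space \<Rightarrow>\<^sub>L 'b::euclidean_space"
  shows "adjoint A y = (\<Sum>b\<in>Basis. (A b \<bullet> y) *\<^sub>R b)"
  using euclidean_representation[of "adjoint A y"]
  by (simp add: inner_adjoint_blinfun inner_commute[of "adjoint A y"])

lemma adjoint_blinfun_diff_left:
  fixes A B :: "'a::euclidean_space \<Rightarrow>\<^sub>L 'b::euclidean_space"
  shows "adjoint (A - B) y = adjoint A y - adjoint B y"
  by (simp add: adjoint_blinfun_expansion blinfun.diff_left inner_diff_left scaleR_diff_left
      sum_subtractf)

lemma adjoint_blinfun_scaleR_left:
  fixes A :: "'a::euclidean_space \<Rightarrow>\<^sub>L 'b::euclidean_space"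
  shows "adjoint (c *\<^sub>R A) y = c *\<^sub>R adjoint A y"
  by (simp add: adjoint_blinfun_expansion blinfun.scaleR_left scaleR_sum_right)

lemma adjoint_blinfun_diff_right:
  fixes A :: "'a::euclidean_space \<Rightarrow>\<^sub>L 'b::euclidean_space"
  shows "adjoint A (x - y) = adjoint A x - adjoint A y"
  by (rule linear_diff[OF adjoint_linear[OF linear_blinfun_apply]])

lemma adjoint_blinfun_scaleR_right:
  fixes A :: "'a::euclidean_space \<Rightarrow>\<^sub>L 'b::euclidean_space"
  shows "adjoint A (c *\<^sub>R x) = c *\<^sub>R adjoint A x"
  by (rule linear_cmul[OF adjoint_linear[OF linear_blinfun_apply]])

lemma adjoint_blinfun_compose:
  fixes A :: "'b::euclidean_space \<Rightarrow>\<^sub>L 'c::euclidean_space" and B :: "'a::euclidean_space \<Rightarrow>\<^sub>L 'b"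
  shows "adjoint (A o\<^sub>L B) y = adjoint B (adjoint A y)"
  by (simp add: vector_eq_ldot[symmetric, of "adjoint (A o\<^sub>L B) y"] inner_adjoint_blinfun)

lemma tendsto_adjoint [tendsto_intros]:
  fixes A :: "'i \<Rightarrow> 'a::euclidean_space \<Rightarrow>\<^sub>L 'b::euclidean_space"
  assumes "(A \<longlongrightarrow> A0) F" and "(m \<longlongrightarrow> m0) F"
  shows "((\<lambda>k. adjoint (A k) (m k)) \<longlongrightarrow> adjoint A0 m0) F"
  unfolding adjoint_blinfun_expansion by (intro tendsto_intros assms)

lemma norm_adjoint_le:
  fixes A :: "'a::euclidean_space \<Rightarrow>\<^sub>L 'b::euclidean_space"
  shows "norm (adjoint A y) \<le> norm A * norm y"
proof (cases "adjoint A y = 0")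
  case False
  have "norm (adjoint A y) * norm (adjoint A y) = A (adjoint A y) \<bullet> y"
    by (simp add: inner_adjoint_blinfun[symmetric] dot_square_norm power2_eq_square)
  also have "\<dots> \<le> norm (A (adjoint A y)) * norm y"
    by (rule norm_cauchy_schwarz)
  also have "\<dots> \<le> norm A * norm (adjoint A y) * norm y"
    by (intro mult_right_mono norm_blinfun norm_ge_zero)
  finally have "norm (adjoint A y) * norm (adjoint A y) \<le> norm (adjoint A y) * (norm A * norm y)"
    by (simp add: mult.commute mult.left_commute)
  then show ?thesis
    using False by simp
qed simp

text \<open>A linear left inverse of the adjoint on the range of \<open>A\<close> recovers a multiplier from the normal
  vector it represents. It gives uniqueness of multipliers, and it carries convergence of normals
  and of their difference quotients over to the multipliers.\<close>

lemma adjoint_left_inverse_on_range: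
  fixes A :: "'a::euclidean_space \<Rightarrow>\<^sub>L 'b::euclidean_space"
  assumes "range A = E"
  obtains C :: "'a \<Rightarrow> 'b" where "linear C" and "\<And>\<mu>. \<mu> \<in> E \<Longrightarrow> C (adjoint A \<mu>) = \<mu>"
proof -
  have sE: "subspace E"
    using assms linear_subspace_image[OF linear_blinfun_apply subspace_UNIV, of A] by simp
  have lin: "linear (adjoint A)"
    by (rule adjoint_linear[OF linear_blinfun_apply])
  have ker: "\<mu> = 0" if \<mu>: "\<mu> \<in> E" and "adjoint A \<mu> = 0" for \<mu>
  proof -
    obtain x where "\<mu> = A x" using \<mu> assms by auto
    then have "\<mu> \<bullet> \<mu> = x \<bullet> adjoint A \<mu>" by (simp add: inner_adjoint_blinfun)
    with that show ?thesis by simp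
  qed
  have "inj_on (adjoint A) E"
    using linear_injective_on_subspace_0[OF lin sE] ker by blast
  from linear_exists_left_inverse_on[OF lin sE this] show ?thesis
    using that by blast
qed

text \<open>Adjoints of maps close to \<open>A\<close> are injective on the range of \<open>A\<close>, with a uniform bound. Together
  with the next lemma, this makes surjectivity onto a subspace stable under small perturbations that
  keep the range in the subspace.\<close>

lemma adjoint_bounded_below_near:
  fixes A :: "'a::euclidean_space \<Rightarrow>\<^sub>L 'b::euclidean_space"
  assumes rA: "range A = E"
  obtains M \<delta> where "M > 0" "\<delta> > 0"
    and "\<And>B \<mu>. norm (B - A) < \<delta> \<Longrightarrow> \<mu> \<in> E \<Longrightarrow> norm \<mu> \<le> M * norm (adjoint B \<mu>)"
proof -
  obtain C where C: "linear C" "\<And>\<mu>. \<mu> \<in> E \<Longrightarrow> C (adjoint A \<mu>) = \<mu>"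
    using adjoint_left_inverse_on_range[OF rA] by blast
  obtain K where K: "K > 0" "\<And>x. norm (C x) \<le> K * norm x"
    using linear_bounded_pos[OF C(1)] by blast
  show ?thesis
  proof (rule that[of "2 * K" "1 / (2 * K)"])
    fix B \<mu> assume B: "norm (B - A) < 1 / (2 * K)" and \<mu>: "\<mu> \<in> E"
    have "adjoint A \<mu> = adjoint B \<mu> - adjoint (B - A) \<mu>"
      by (simp add: adjoint_blinfun_diff_left)
    then have "norm (adjoint A \<mu>) \<le> norm (adjoint B \<mu>) + norm (adjoint (B - A) \<mu>)"
      by (simp add: norm_triangle_ineq4)
    also have "norm (adjoint (B - A) \<mu>) \<le> 1 / (2 * K) * norm \<mu>"
      by (rule order_trans[OF norm_adjoint_le]) (use B in \<open>intro mult_right_mono, auto\<close>)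
    finally have *: "norm (adjoint A \<mu>) \<le> norm (adjoint B \<mu>) + 1 / (2 * K) * norm \<mu>" by simp
    have "norm \<mu> \<le> K * norm (adjoint A \<mu>)"
      using K(2)[of "adjoint A \<mu>"] C(2)[OF \<mu>] by simp
    also have "\<dots> \<le> K * (norm (adjoint B \<mu>) + 1 / (2 * K) * norm \<mu>)"
      using * K(1) by simp
    also have "\<dots> = K * norm (adjoint B \<mu>) + norm \<mu> / 2"
      using K(1) by (simp add: field_simps)
    finally show "norm \<mu> \<le> 2 * K * norm (adjoint B \<mu>)" by simp
  qed (use K in auto)
qed

text \<open>If the range were a proper subspace of \<open>E\<close>, a nonzero vector of \<open>E\<close> orthogonal to it would lie
  in the kernel of the adjoint.\<close>

lemma range_eq_if_adjoint_bounded_below: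
  fixes A :: "'a::euclidean_space \<Rightarrow>\<^sub>L 'b::euclidean_space"
  assumes "subspace E" and "range A \<subseteq> E"
    and "\<And>\<mu>. \<mu> \<in> E \<Longrightarrow> norm \<mu> \<le> M * norm (adjoint A \<mu>)"
  shows "range A = E"
proof (rule ccontr)
  assume neq: "range A \<noteq> E"
  have sR: "subspace (range A)"
    using linear_subspace_image[OF linear_blinfun_apply subspace_UNIV, of A] by simp
  have "span (range A) \<subset> span E"
    using neq assms(1,2) sR by (simp add: span_eq_iff[THEN iffD2] psubset_eq)
  then obtain \<mu> where \<mu>: "\<mu> \<noteq> 0" "\<mu> \<in> span E" "\<And>x. x \<in> span (range A) \<Longrightarrow> orthogonal \<mu> x"
    using orthogonal_to_subspace_exists_gen by metis
  have "x \<bullet> adjoint A \<mu> = 0" for x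
    using \<mu>(3)[of "A x"] by (simp add: span_base inner_adjoint_blinfun orthogonal_def inner_commute)
  then have "adjoint A \<mu> = 0"
    by (metis inner_eq_zero_iff)
  then show False
    using assms(3)[of \<mu>] \<mu>(1,2) assms(1) by (simp add: span_eq_iff[THEN iffD2])
qed

section \<open>Difference quotients\<close>

text \<open>Differentiability at a point is used throughout in this form: difference quotients are taken
  along arbitrary points \<open>X k\<close> that leave \<open>x\<close> with a velocity \<open>d\<close> relative to the step sizes \<open>t k\<close>.
  The first conclusion only says that such points converge to \<open>x\<close>.\<close>

lemma tendsto_difference_quotient:
  fixes f :: "'a::real_normed_vector \<Rightarrow> 'b::real_normed_vector"
  assumes der: "(f has_derivative f') (at x)" and t0: "(t \<longlongrightarrow> 0) F"
    and tpos: "\<forall>\<^sub>F k in F. 0 < (t k :: real)"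
    and X: "((\<lambda>k. (X k - x) /\<^sub>R t k) \<longlongrightarrow> d) F"
  shows "(X \<longlongrightarrow> x) F" and "((\<lambda>k. (f (X k) - f x) /\<^sub>R t k) \<longlongrightarrow> f' d) F"
proof -
  have lim: "((\<lambda>k. x + t k *\<^sub>R ((X k - x) /\<^sub>R t k)) \<longlongrightarrow> x + 0 *\<^sub>R d) F"
    by (intro tendsto_intros t0 X)
  have "\<forall>\<^sub>F k in F. x + t k *\<^sub>R ((X k - x) /\<^sub>R t k) = X k"
    using tpos by eventually_elim simp
  from Lim_transform_eventually[OF lim this] show Xx: "(X \<longlongrightarrow> x) F"
    by simp
  define r where "r u = (f u - f x - f' (u - x)) /\<^sub>R norm (u - x)" for u
  have blf: "bounded_linear f'" using der by (rule has_derivative_bounded_linear)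
  have "(r \<longlongrightarrow> r x) (at x)"
    using der by (simp add: has_derivative_at_within r_def[abs_def])
  then have "((\<lambda>k. r (X k)) \<longlongrightarrow> r x) F"
    using isCont_tendsto_compose[OF _ Xx, of r] by (simp add: isCont_def)
  then have lim: "((\<lambda>k. f' ((X k - x) /\<^sub>R t k) + norm ((X k - x) /\<^sub>R t k) *\<^sub>R r (X k))
      \<longlongrightarrow> f' d + norm d *\<^sub>R r x) F"
    by (intro tendsto_intros bounded_linear.tendsto[OF blf] X)
  have "\<forall>\<^sub>F k in F. f' ((X k - x) /\<^sub>R t k) + norm ((X k - x) /\<^sub>R t k) *\<^sub>R r (X k)
      = (f (X k) - f x) /\<^sub>R t k"
    using tpos
  proof eventually_elim
    case (elim k)
    show ?case
      using elim linear_0[OF bounded_linear.linear[OF blf]]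
      by (cases "X k = x")
        (simp_all add: r_def linear_cmul[OF bounded_linear.linear[OF blf]] mult.assoc,
          simp add: algebra_simps)
  qed
  from Lim_transform_eventually[OF lim this]
  show "((\<lambda>k. (f (X k) - f x) /\<^sub>R t k) \<longlongrightarrow> f' d) F"
    by (simp add: r_def)
qed

lemma derivative_in_subspace:
  fixes f :: "'a::euclidean_space \<Rightarrow> 'b::euclidean_space"
  assumes der: "(f has_derivative f') (at x)" and U: "open U" "x \<in> U" "f ` U \<subseteq> E" and E: "subspace E"
  shows "range f' \<subseteq> E"
proof clarify
  fix h
  have pos: "\<forall>\<^sub>F t in at_right 0. 0 < (t::real)"
    by (rule eventually_at_right_less)
  have quot: "((\<lambda>t. (x + t *\<^sub>R h - x) /\<^sub>R t) \<longlongrightarrow> h) (at_right 0)"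
    by (rule tendsto_eventually) (use pos in eventually_elim, simp)
  note lims = tendsto_difference_quotient[OF der tendsto_ident_at pos quot]
  have "\<forall>\<^sub>F t in at_right 0. x + t *\<^sub>R h \<in> U"
    using topological_tendstoD[OF lims(1) U(1,2)] .
  then have "\<forall>\<^sub>F t in at_right 0. (f (x + t *\<^sub>R h) - f x) /\<^sub>R t \<in> E"
    by eventually_elim (use U E in \<open>auto intro!: subspace_scale subspace_diff\<close>)
  then show "f' h \<in> E"
    by (rule Lim_in_closed_set[OF closed_subspace[OF E] _ _ lims(2)]) simp
qed

text \<open>The product rule for the bilinear expression \<open>adjoint A m\<close>, along difference quotients with
  step sizes \<open>t\<close>.\<close>

lemma tendsto_adjoint_difference_quotient:
  fixes A :: "'i \<Rightarrow> 'a::euclidean_space \<Rightarrow>\<^sub>L 'b::euclidean_space"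
  assumes t0: "(t \<longlongrightarrow> 0) F" and tpos: "\<forall>\<^sub>F k in F. 0 < (t k :: real)"
    and A: "((\<lambda>k. (A k - A0) /\<^sub>R t k) \<longlongrightarrow> B) F"
    and m: "((\<lambda>k. (m k - m0) /\<^sub>R t k) \<longlongrightarrow> p) F"
  shows "((\<lambda>k. (adjoint (A k) (m k) - adjoint A0 m0) /\<^sub>R t k) \<longlongrightarrow> adjoint B m0 + adjoint A0 p) F"
proof -
  have m0: "(m \<longlongrightarrow> m0) F"
    by (rule tendsto_difference_quotient(1)[OF has_derivative_ident t0 tpos m])
  have "((\<lambda>k. adjoint ((A k - A0) /\<^sub>R t k) (m k) + adjoint A0 ((m k - m0) /\<^sub>R t k))
      \<longlongrightarrow> adjoint B m0 + adjoint A0 p) F"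
    by (intro tendsto_intros A m m0)
  then show ?thesis
    by (simp add: adjoint_blinfun_diff_left adjoint_blinfun_diff_right adjoint_blinfun_scaleR_left
        adjoint_blinfun_scaleR_right scaleR_right_distrib[symmetric])
qed

text \<open>For a nonexpansive map the directional derivative is also attained along moving directions,
  so that metric projections can be differentiated along sequences of points.\<close>

lemma tendsto_directional_difference_quotient:
  assumes dir: "has_dir_derivative f x h d" and lip: "\<And>a b. dist (f a) (f b) \<le> dist a b"
    and t0: "(t \<longlongrightarrow> 0) F" and tpos: "\<forall>\<^sub>F k in F. 0 < t k"
    and X: "((\<lambda>k. (X k - x) /\<^sub>R t k) \<longlongrightarrow> h) F"
  shows "((\<lambda>k. (f (X k) - f x) /\<^sub>R t k) \<longlongrightarrow> d) F"
proof -
  have "filterlim t (at_right 0) F"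
    unfolding filterlim_at using t0 tpos by (auto elim: eventually_mono)
  from filterlim_compose[OF dir[unfolded has_dir_derivative_def] this]
  have 1: "((\<lambda>k. (f (x + t k *\<^sub>R h) - f x) /\<^sub>R t k) \<longlongrightarrow> d) F" .
  have 2: "((\<lambda>k. norm ((X k - x) /\<^sub>R t k - h)) \<longlongrightarrow> 0) F"
    using tendsto_norm_zero[OF LIM_zero[OF X]] .
  have "((\<lambda>k. (f (X k) - f (x + t k *\<^sub>R h)) /\<^sub>R t k) \<longlongrightarrow> 0) F"
  proof (rule Lim_null_comparison[OF _ 2])
    show "\<forall>\<^sub>F k in F. norm ((f (X k) - f (x + t k *\<^sub>R h)) /\<^sub>R t k) \<le> norm ((X k - x) /\<^sub>R t k - h)"
      using tpos
    proof eventually_elim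
      case (elim k)
      have "norm ((f (X k) - f (x + t k *\<^sub>R h)) /\<^sub>R t k) \<le> norm (X k - (x + t k *\<^sub>R h)) / t k"
        using elim lip[of "X k" "x + t k *\<^sub>R h"] by (simp add: dist_norm divide_simps)
      also have "\<dots> = norm ((1 / t k) *\<^sub>R (X k - (x + t k *\<^sub>R h)))" using elim by simp
      also have "(1 / t k) *\<^sub>R (X k - (x + t k *\<^sub>R h)) = (X k - x) /\<^sub>R t k - h"
        using elim by (simp add: algebra_simps inverse_eq_divide)
      finally show ?case .
    qed
  qed
  from tendsto_add[OF this 1] show ?thesis
    by (simp add: scaleR_right_distrib[symmetric])
qed

section \<open>Tangent cones and normal cones\<close>

text \<open>The tangent cone of a convex set is the closure of its cone of feasible directions; closedness
  and convexity of the tangent cone are read off from this.\<close>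

lemma tangent_cone_convex_eq:
  assumes C: "convex C" and z: "z \<in> C"
  shows "tangent_cone C z = closure {s *\<^sub>R (c - z) |s c. 0 \<le> s \<and> c \<in> C}" (is "_ = closure ?R")
proof (intro set_eqI iffI)
  fix d assume "d \<in> tangent_cone C z"
  then obtain t :: "nat \<Rightarrow> real" and d' where t: "\<And>k. t k > 0" and d': "d' \<longlonglongrightarrow> d"
    and inC: "\<And>k. z + t k *\<^sub>R d' k \<in> C"
    unfolding tangent_cone_def by blast
  have "d' k \<in> ?R" for k
  proof -
    have "d' k = (1 / t k) *\<^sub>R ((z + t k *\<^sub>R d' k) - z)"
      using t[of k] by simp
    then show ?thesis
      using inC[of k] t[of k] by (intro CollectI exI[of _ "1 / t k"] exI[of _ "z + t k *\<^sub>R d' k"]) auto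
  qed
  then show "d \<in> closure ?R"
    using d' closure_sequential by blast
next
  fix d assume "d \<in> closure ?R"
  then obtain d' where d': "\<And>k::nat. d' k \<in> ?R" "d' \<longlonglongrightarrow> d"
    using closure_sequential by blast
  from d'(1) have "\<forall>k. \<exists>s c. d' k = s *\<^sub>R (c - z) \<and> 0 \<le> s \<and> c \<in> C" by blast
  then obtain s c where sc: "\<And>k. d' k = s k *\<^sub>R (c k - z)" "\<And>k. 0 \<le> s k" "\<And>k. c k \<in> C"
    by metis
  \<comment> \<open>The factor \<open>1 / (s k + 1)\<close> keeps \<open>t k * s k \<le> 1\<close>, so that the points below stay on the segment
    from \<open>z\<close> to \<open>c k\<close>.\<close>
  define t where "t k = (1 / (real k + 1)) * (1 / (s k + 1))" for k
  have tpos: "t k > 0" for k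
    using sc(2)[of k] by (simp add: t_def)
  have inv0: "(\<lambda>k. 1 / (real k + 1)) \<longlonglongrightarrow> 0"
    using LIMSEQ_inverse_real_of_nat by (simp add: inverse_eq_divide add.commute)
  have "t \<longlonglongrightarrow> 0"
  proof (rule Lim_null_comparison[OF _ inv0], rule always_eventually, rule allI)
    show "norm (t k) \<le> 1 / (real k + 1)" for k
      using tpos[of k] mult_left_le[of "1 / (s k + 1)" "1 / (real k + 1)"] sc(2)[of k]
      by (simp add: t_def)
  qed
  moreover have "z + t k *\<^sub>R d' k \<in> C" for k
  proof -
    have "t k * s k \<le> 1"
    proof -
      have "t k * s k = (1 / (real k + 1)) * (s k / (s k + 1))" by (simp add: t_def)
      also have "\<dots> \<le> 1 * 1"
        by (rule mult_mono) (use sc(2)[of k] in \<open>auto simp: divide_simps\<close>)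
      finally show ?thesis by simp
    qed
    then have "(1 - t k * s k) *\<^sub>R z + (t k * s k) *\<^sub>R c k \<in> C"
      using convexD_alt[OF C z sc(3)[of k], of "t k * s k"] tpos[of k] sc(2)[of k] by simp
    moreover have "z + t k *\<^sub>R d' k = (1 - t k * s k) *\<^sub>R z + (t k * s k) *\<^sub>R c k"
      by (simp add: sc(1) algebra_simps)
    ultimately show ?thesis by simp
  qed
  ultimately show "d \<in> tangent_cone C z"
    using tpos d'(2) unfolding tangent_cone_def by blast
qed

lemma closed_tangent_cone_convex:
  assumes "convex C" and "z \<in> C"
  shows "closed (tangent_cone C z)"
  by (simp add: tangent_cone_convex_eq[OF assms])

lemma convex_tangent_cone:
  assumes C: "convex C" and z: "z \<in> C"
  shows "convex (tangent_cone C z)"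
proof -
  have "convex {s *\<^sub>R (c - z) |s c. 0 \<le> s \<and> c \<in> C}"
  proof (rule convexI, clarify)
    fix u v s c s' c' :: real and a b
    assume uv: "0 \<le> u" "0 \<le> v" "u + v = 1" and s: "0 \<le> s" "a \<in> C" "0 \<le> s'" "b \<in> C"
    define p where "p = u * s + v * s'"
    show "\<exists>q c. u *\<^sub>R s *\<^sub>R (a - z) + v *\<^sub>R s' *\<^sub>R (b - z) = q *\<^sub>R (c - z) \<and> 0 \<le> q \<and> c \<in> C"
    proof (cases "p = 0")
      case True
      then have "u * s = 0" "v * s' = 0"
        using uv s by (simp_all add: p_def add_nonneg_eq_0_iff)
      then show ?thesis using z by (intro exI[of _ 0] exI[of _ z]) (auto simp del: mult_eq_0_iff)
    next
      case False
      then have p: "p > 0" using uv s by (simp add: p_def less_le)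
      have eq: "p *\<^sub>R ((u * s / p) *\<^sub>R a + (v * s' / p) *\<^sub>R b - z)
          = u *\<^sub>R s *\<^sub>R (a - z) + v *\<^sub>R s' *\<^sub>R (b - z)"
        using p by (simp add: algebra_simps) (simp add: p_def algebra_simps)
      have "(u * s / p) *\<^sub>R a + (v * s' / p) *\<^sub>R b \<in> C"
        by (rule convexD[OF C s(2,4)])
          (use p uv s in \<open>auto simp: p_def add_divide_distrib[symmetric]\<close>)
      then show ?thesis using eq p by (metis less_imp_le)
    qed
  qed
  then show ?thesis
    by (simp add: tangent_cone_convex_eq[OF assms] convex_closure)
qed

lemma zero_in_tangent_cone:
  assumes "z \<in> C"
  shows "0 \<in> tangent_cone C z"
  unfolding tangent_cone_def
  using assms LIMSEQ_inverse_real_of_nat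
  by (intro CollectI exI[of _ "\<lambda>k. inverse (real (Suc k))"] exI[of _ "\<lambda>_. 0"]) auto

lemma tangent_cone_scaleR:
  assumes d: "d \<in> tangent_cone C z" and r: "r > 0"
  shows "r *\<^sub>R d \<in> tangent_cone C z"
proof -
  obtain t :: "nat \<Rightarrow> real" and d' where t: "\<And>k. t k > 0" "t \<longlonglongrightarrow> 0" and d': "d' \<longlonglongrightarrow> d"
    and inC: "\<And>k. z + t k *\<^sub>R d' k \<in> C"
    using d unfolding tangent_cone_def by blast
  have "(\<lambda>k. t k / r) \<longlonglongrightarrow> 0" using tendsto_divide_zero[OF t(2)] .
  moreover have "(\<lambda>k. r *\<^sub>R d' k) \<longlonglongrightarrow> r *\<^sub>R d" by (intro tendsto_intros d')
  moreover have "z + (t k / r) *\<^sub>R (r *\<^sub>R d' k) \<in> C" for k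
    using inC[of k] r by simp
  ultimately show ?thesis
    using t(1) r unfolding tangent_cone_def
    by (intro CollectI exI[of _ "\<lambda>k. t k / r"] exI[of _ "\<lambda>k. r *\<^sub>R d' k"]) auto
qed

lemma tangent_coneI_eventually:
  fixes t :: "nat \<Rightarrow> real"
  assumes t: "\<forall>\<^sub>F k in sequentially. 0 < t k" "t \<longlonglongrightarrow> 0" and d: "d' \<longlonglongrightarrow> d"
    and ev: "\<forall>\<^sub>F k in sequentially. z + t k *\<^sub>R d' k \<in> C"
  shows "d \<in> tangent_cone C z"
proof -
  obtain N where N: "\<And>k. k \<ge> N \<Longrightarrow> 0 < t k \<and> z + t k *\<^sub>R d' k \<in> C"
    using eventually_conj[OF t(1) ev] unfolding eventually_sequentially by blast
  show ?thesis
    unfolding tangent_cone_def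
    using N LIMSEQ_ignore_initial_segment[OF t(2), of N] LIMSEQ_ignore_initial_segment[OF d, of N]
    by (intro CollectI exI[of _ "\<lambda>k. t (k + N)"] exI[of _ "\<lambda>k. d' (k + N)"]) auto
qed

text \<open>The lineality space of a convex cone \<open>Q\<close> is \<open>Q \<inter> - Q\<close>; in particular a greatest subspace of
  \<open>Q\<close> exists, so that \<^const>\<open>lin\<close> has its intended meaning.\<close>

lemma lin_convex_cone:
  fixes Q :: "'a::real_vector set"
  assumes Q: "convex Q" "0 \<in> Q" "\<And>r d. r > 0 \<Longrightarrow> d \<in> Q \<Longrightarrow> r *\<^sub>R d \<in> Q"
  shows "lin Q = Q \<inter> uminus ` Q"
proof -
  have add: "a + b \<in> Q" if "a \<in> Q" "b \<in> Q" for a b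
  proof -
    have "(1/2) *\<^sub>R a + (1/2) *\<^sub>R b \<in> Q"
      using convexD[OF Q(1) that, of "1/2" "1/2"] by simp
    from Q(3)[OF _ this, of 2] show ?thesis by (simp add: scaleR_right_distrib)
  qed
  have mem: "x \<in> Q \<inter> uminus ` Q \<longleftrightarrow> x \<in> Q \<and> - x \<in> Q" for x
    by (auto simp: image_iff) (metis minus_minus)
  have sub: "subspace (Q \<inter> uminus ` Q)"
  proof (rule subspaceI)
    show "0 \<in> Q \<inter> uminus ` Q" using Q(2) unfolding mem by simp
    show "x + y \<in> Q \<inter> uminus ` Q" if "x \<in> Q \<inter> uminus ` Q" "y \<in> Q \<inter> uminus ` Q" for x y
      using that add[of x y] add[of "-x" "-y"] unfolding mem by simp
    show "c *\<^sub>R x \<in> Q \<inter> uminus ` Q" if "x \<in> Q \<inter> uminus ` Q" for c x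
    proof -
      consider "c = 0" | "c > 0" | "- c > 0" by linarith
      then show ?thesis
      proof cases
        case 1 then show ?thesis using Q(2) unfolding mem by simp
      next
        case 2 then show ?thesis using that Q(3)[of c x] Q(3)[of c "-x"] unfolding mem by simp
      next
        case 3 then show ?thesis using that Q(3)[of "-c" x] Q(3)[of "-c" "-x"] unfolding mem by simp
      qed
    qed
  qed
  have "L \<subseteq> Q \<inter> uminus ` Q" if "subspace L \<and> L \<subseteq> Q" for L
    using that subspace_neg[of L] unfolding subset_iff mem by blast
  then show ?thesis
    unfolding lin_def using sub by (intro Greatest_equality) auto
qed

lemma lin_tangent_cone_convex:
  assumes "convex C" and "z \<in> C"
  shows "lin (tangent_cone C z) = tangent_cone C z \<inter> uminus ` tangent_cone C z"
  using convex_tangent_cone[OF assms] zero_in_tangent_cone[OF assms(2)] tangent_cone_scaleR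
  by (intro lin_convex_cone) blast+

lemma normal_coneI: "z \<in> C \<Longrightarrow> (\<And>c. c \<in> C \<Longrightarrow> w \<bullet> (c - z) \<le> 0) \<Longrightarrow> w \<in> normal_cone C z"
  by (simp add: normal_cone_def)

lemma normal_coneD:
  assumes "w \<in> normal_cone C z"
  shows "z \<in> C" and "c \<in> C \<Longrightarrow> w \<bullet> (c - z) \<le> 0"
  using assms by (auto simp: normal_cone_def split: if_splits)

text \<open>The variational characterization of the metric projection. It turns membership in the graph of
  the normal cone mapping into an equation for the projection.\<close>

lemma closest_point_eq_iff_normal_cone:
  fixes C :: "'a::euclidean_space set"
  assumes C: "convex C" "closed C" "C \<noteq> {}"
  shows "closest_point C x = z \<longleftrightarrow> x - z \<in> normal_cone C z"
proof
  assume "closest_point C x = z"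
  then show "x - z \<in> normal_cone C z"
    using closest_point_dot[OF C(1,2)] closest_point_in_set[OF C(2,3)]
    by (auto intro!: normal_coneI)
next
  assume n: "x - z \<in> normal_cone C z"
  have "dist x z \<le> dist x c" if c: "c \<in> C" for c
  proof -
    have "(norm (x - z))\<^sup>2 \<le> (norm (x - z))\<^sup>2 + (norm (c - z))\<^sup>2 - 2 * ((x - z) \<bullet> (c - z))"
      using normal_coneD(2)[OF n c] by (smt (verit) zero_le_power2)
    also have "\<dots> = (norm (x - c))\<^sup>2"
      using dot_norm_neg[of "x - z" "c - z"] by (simp add: field_simps)
    finally show ?thesis
      by (simp add: dist_norm power2_le_iff_abs_le)
  qed
  then show "closest_point C x = z"
    using closest_point_unique[OF C(1,2) normal_coneD(1)[OF n]] by metis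
qed

lemma regular_normal_cone_iff:
  "v \<in> regular_normal_cone S y \<longleftrightarrow>
     y \<in> S \<and> (\<forall>e>0. \<forall>\<^sub>F u in at y within S. v \<bullet> (u - y) \<le> e * norm (u - y))"
proof (cases "y \<in> S")
  case True
  have "Limsup (at y within S) (\<lambda>u. ereal (v \<bullet> (u - y) / norm (u - y))) \<le> 0
     \<longleftrightarrow> (\<forall>e>0. \<forall>\<^sub>F u in at y within S. v \<bullet> (u - y) \<le> e * norm (u - y))" (is "?L \<longleftrightarrow> ?R")
  proof
    assume L: ?L
    show ?R
    proof (intro allI impI)
      fix e :: real assume "e > 0"
      then have "\<forall>\<^sub>F u in at y within S. ereal (v \<bullet> (u - y) / norm (u - y)) < ereal e"
        using L unfolding Limsup_le_iff by (metis ereal_less(2))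
      moreover have "\<forall>\<^sub>F u in at y within S. u \<noteq> y"
        by (simp add: eventually_at_filter)
      ultimately show "\<forall>\<^sub>F u in at y within S. v \<bullet> (u - y) \<le> e * norm (u - y)"
        by eventually_elim (simp add: field_simps)
    qed
  next
    assume R: ?R
    show ?L
      unfolding Limsup_le_iff
    proof (intro allI impI)
      fix b :: ereal assume "0 < b"
      then obtain e where e: "0 < ereal e" "ereal e < b"
        using ereal_dense2 by blast
      then have "\<forall>\<^sub>F u in at y within S. v \<bullet> (u - y) \<le> e * norm (u - y)"
        using R by simp
      moreover have "\<forall>\<^sub>F u in at y within S. u \<noteq> y"
        by (simp add: eventually_at_filter)
      ultimately show "\<forall>\<^sub>F u in at y within S. ereal (v \<bullet> (u - y) / norm (u - y)) < b"
      proof eventually_elim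
        case (elim u)
        then have "v \<bullet> (u - y) / norm (u - y) \<le> e" by (simp add: field_simps)
        then show ?case using e(2) by (metis ereal_less_eq(3) order_le_less_trans)
      qed
    qed
  qed
  then show ?thesis using True by (simp add: regular_normal_cone_def)
qed (simp add: regular_normal_cone_def)

lemma regular_normal_cone_convex:
  fixes C :: "'a::real_inner set"
  assumes C: "convex C"
  shows "regular_normal_cone C z = normal_cone C z"
proof (intro set_eqI iffI)
  fix w assume w: "w \<in> normal_cone C z"
  have "\<forall>\<^sub>F u in at z within C. w \<bullet> (u - z) \<le> e * norm (u - z)" if "e > 0" for e
    unfolding eventually_at_filter
  proof (rule always_eventually, intro allI impI)
    fix u assume "u \<in> C"
    then have "w \<bullet> (u - z) \<le> 0" by (rule normal_coneD(2)[OF w])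
    also have "0 \<le> e * norm (u - z)" using that by simp
    finally show "w \<bullet> (u - z) \<le> e * norm (u - z)" .
  qed
  then show "w \<in> regular_normal_cone C z"
    using normal_coneD(1)[OF w] by (simp add: regular_normal_cone_iff)
next
  fix w assume w: "w \<in> regular_normal_cone C z"
  then have z: "z \<in> C" by (simp add: regular_normal_cone_iff)
  show "w \<in> normal_cone C z"
  proof (rule normal_coneI[OF z], rule field_le_epsilon)
    fix c and e :: real assume c: "c \<in> C" and e: "e > 0"
    show "w \<bullet> (c - z) \<le> 0 + e"
    proof (cases "c = z")
      case False
      define e' where "e' = e / norm (c - z)"
      have e': "e' > 0" using e False by (simp add: e'_def)
      obtain d where d: "d > 0"
        "\<And>u. u \<in> C \<Longrightarrow> u \<noteq> z \<Longrightarrow> dist u z < d \<Longrightarrow> w \<bullet> (u - z) \<le> e' * norm (u - z)"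
        using w e' unfolding regular_normal_cone_iff eventually_at by blast
      define s where "s = min 1 (d / (2 * norm (c - z)))"
      have s: "0 < s" "s \<le> 1" using d(1) False by (auto simp: s_def)
      define u where "u = z + s *\<^sub>R (c - z)"
      have "u = (1 - s) *\<^sub>R z + s *\<^sub>R c" by (simp add: u_def algebra_simps)
      then have "u \<in> C" using convexD_alt[OF C z c] s by simp
      moreover have "u \<noteq> z" using s False by (simp add: u_def)
      moreover have "dist u z < d"
      proof -
        have "dist u z = s * norm (c - z)" using s by (simp add: u_def dist_norm)
        also have "\<dots> \<le> d / (2 * norm (c - z)) * norm (c - z)"
          by (intro mult_right_mono) (simp_all add: s_def)
        also have "\<dots> < d" using d(1) False by simp
        finally show ?thesis .
      qed
      ultimately have "w \<bullet> (u - z) \<le> e' * norm (u - z)" by (rule d(2))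
      then have "s * (w \<bullet> (c - z)) \<le> s * (e' * norm (c - z))"
        using s by (simp add: u_def mult.left_commute)
      then show ?thesis using s False by (simp add: e'_def)
    qed (use e in simp)
  qed
qed

text \<open>The complementarity condition of the KKT system, stated on the polar cone, in its primal form.
  The bipolar theorem is not needed because \<open>z\<close> is known to lie in the cone.\<close>

lemma normal_cone_convex_cone_iff:
  assumes "convex_cone \<Theta>" and z: "z \<in> \<Theta>"
  shows "z \<in> normal_cone (polar_cone \<Theta>) \<nu> \<longleftrightarrow> \<nu> \<in> normal_cone \<Theta> z"
proof
  assume n: "z \<in> normal_cone (polar_cone \<Theta>) \<nu>"
  have \<nu>: "\<nu> \<in> polar_cone \<Theta>" using normal_coneD(1)[OF n] .
  have "0 \<in> polar_cone \<Theta>" by (simp add: polar_cone_def)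
  from normal_coneD(2)[OF n this] have "\<nu> \<bullet> z \<ge> 0" by (simp add: inner_commute)
  with \<nu> z show "\<nu> \<in> normal_cone \<Theta> z"
    by (intro normal_coneI) (auto simp: polar_cone_def inner_diff_right intro: order_trans)
next
  assume n: "\<nu> \<in> normal_cone \<Theta> z"
  have cone: "c *\<^sub>R x \<in> \<Theta>" if "x \<in> \<Theta>" "c \<ge> 0" for x c
    using assms(1) that by (simp add: convex_cone_def conic_def)
  have "\<nu> \<bullet> (2 *\<^sub>R z - z) \<le> 0" "\<nu> \<bullet> (0 *\<^sub>R z - z) \<le> 0"
    by (rule normal_coneD(2)[OF n cone[OF z]], simp)+
  then have 0: "\<nu> \<bullet> z = 0" by (simp add: inner_diff_right)
  have "\<nu> \<bullet> c \<le> 0" if "c \<in> \<Theta>" for c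
    using normal_coneD(2)[OF n that] 0 by (simp add: inner_diff_right)
  then have "\<nu> \<in> polar_cone \<Theta>" by (simp add: polar_cone_def)
  then show "z \<in> normal_cone (polar_cone \<Theta>) \<nu>"
    using 0 z by (intro normal_coneI) (auto simp: polar_cone_def inner_diff_right inner_commute)
qed

lemma derivative_tangent_cone:
  assumes der: "(f has_derivative f') (at z)" and V: "open V" "z \<in> V"
    and S: "\<And>x. x \<in> V \<Longrightarrow> x \<in> S \<Longrightarrow> f x \<in> R" and d: "d \<in> tangent_cone S z"
  shows "f' d \<in> tangent_cone R (f z)"
proof -
  obtain t :: "nat \<Rightarrow> real" and d' where t: "\<And>k. t k > 0" "t \<longlonglongrightarrow> 0" and d': "d' \<longlonglongrightarrow> d"
    and inS: "\<And>k. z + t k *\<^sub>R d' k \<in> S"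
    using d unfolding tangent_cone_def by blast
  have quot: "(\<lambda>k. (z + t k *\<^sub>R d' k - z) /\<^sub>R t k) \<longlonglongrightarrow> d"
    using d' t(1) by (simp add: less_imp_neq[symmetric])
  have tpos: "\<forall>\<^sub>F k in sequentially. 0 < t k" using t(1) by simp
  note lims = tendsto_difference_quotient[OF der t(2) tpos quot]
  have "\<forall>\<^sub>F k in sequentially. z + t k *\<^sub>R d' k \<in> V"
    using topological_tendstoD[OF lims(1) V] .
  then have "\<forall>\<^sub>F k in sequentially.
      f z + t k *\<^sub>R ((f (z + t k *\<^sub>R d' k) - f z) /\<^sub>R t k) \<in> R"
    by eventually_elim (use inS S t(1) in \<open>simp add: less_imp_neq[symmetric]\<close>)
  then show ?thesis
    by (rule tangent_coneI_eventually[OF tpos t(2) lims(2)])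
qed

section \<open>Regular normals to preimages\<close>

text \<open>Let \<open>f\<close> take its values in the subspace \<open>E\<close> and have a derivative at \<open>x\<close> that is onto \<open>E\<close>. Then any
  curve \<open>e\<close> in \<open>E\<close> that leaves \<open>f x\<close> with velocity \<open>f' d\<close> can be lifted through \<open>f\<close> to points
  \<open>x + t *\<^sub>R d + o(t)\<close>. Only differentiability at \<open>x\<close> and continuity near \<open>x\<close> are required: with a right
  inverse \<open>B\<close> of \<open>f'\<close>, the correction \<open>s\<close> in \<open>f (x + t *\<^sub>R d + B s) = e t\<close> is a fixed point provided
  by the theorem of Brouwer on a ball of radius proportional to \<open>\<epsilon> * t\<close>.\<close>

lemma solve_along_direction:
  fixes f :: "'a::euclidean_space \<Rightarrow> 'b::euclidean_space"
  assumes der: "(f has_derivative f') (at x)" and U: "open U" "x \<in> U" and contf: "continuous_on U f"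
    and fE: "f ` U \<subseteq> E" and E: "subspace E" and rng: "range f' = E"
    and eE: "\<forall>\<^sub>F t in at_right 0. e t \<in> E"
    and e: "((\<lambda>t. (e t - f x) /\<^sub>R t) \<longlongrightarrow> f' d) (at_right 0)" and \<epsilon>: "\<epsilon> > 0"
  shows "\<forall>\<^sub>F t in at_right 0. \<exists>u\<in>U. norm (u - (x + t *\<^sub>R d)) \<le> \<epsilon> * t \<and> f u = e t"
proof -
  have lin: "linear f'" using der by (rule has_derivative_linear)
  obtain B where B: "linear B" "\<And>s. s \<in> E \<Longrightarrow> f' (B s) = s"
    using linear_exists_right_inverse_on[OF lin subspace_UNIV] rng by blast
  obtain K where K: "K > 0" "\<And>s. norm (B s) \<le> K * norm s"
    using linear_bounded_pos[OF B(1)] by blast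
  \<comment> \<open>Corrections \<open>s\<close> of norm at most \<open>\<delta> * t\<close> move the point by at most \<open>\<epsilon> * t\<close>. The linearization
    error and the deviation of \<open>e\<close> from its velocity each use up one half of \<open>\<delta> * t\<close>.\<close>
  define \<delta> where "\<delta> = \<epsilon> / K"
  have \<delta>: "\<delta> > 0" using K \<epsilon> by (simp add: \<delta>_def)
  define L where "L = norm d + \<epsilon>"
  have L: "L > 0" using \<epsilon> by (simp add: L_def add_nonneg_pos)
  obtain r1 where r1: "r1 > 0"
    "\<And>u. norm (u - x) < r1 \<Longrightarrow> norm (f u - f x - f' (u - x)) \<le> \<delta> / (2 * L) * norm (u - x)"
    using der \<delta> L unfolding has_derivative_at_alt by (metis divide_pos_pos mult_pos_pos zero_less_numeral)
  obtain r2 where r2: "r2 > 0" "ball x r2 \<subseteq> U"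
    using U open_contains_ball by blast
  define r where "r = min r1 r2"
  have r: "r > 0" using r1 r2 by (simp add: r_def)
  have "\<forall>\<^sub>F t in at_right 0. dist ((e t - f x) /\<^sub>R t) (f' d) < \<delta> / 2"
    using tendstoD[OF e, of "\<delta> / 2"] \<delta> by simp
  moreover have "\<forall>\<^sub>F t in at_right 0. t < r / L"
    using r L by (intro eventually_at_right_real[of 0 "r / L", THEN eventually_mono]) auto
  moreover have "\<forall>\<^sub>F t in at_right 0. 0 < (t::real)" by (rule eventually_at_right_less)
  ultimately show ?thesis
    using eE
  proof eventually_elim
    case (elim t)
    then have t: "t > 0" and tr: "t * L < r" using L by (simp_all add: field_simps)
    define T where "T = cball 0 (\<delta> * t) \<inter> E"
    define \<phi> where "\<phi> s = s - (f (x + t *\<^sub>R d + B s) - e t)" for s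
    have Bs: "norm (B s) \<le> \<epsilon> * t" if "s \<in> T" for s
    proof -
      have "norm (B s) \<le> K * norm s" by (rule K)
      also have "\<dots> \<le> K * (\<delta> * t)" using that K by (simp add: T_def)
      also have "\<dots> = \<epsilon> * t" using K by (simp add: \<delta>_def)
      finally show ?thesis .
    qed
    have step: "norm (t *\<^sub>R d + B s) \<le> t * L" if "s \<in> T" for s
      using norm_triangle_ineq[of "t *\<^sub>R d" "B s"] Bs[OF that] t by (simp add: L_def algebra_simps)
    have inU: "x + t *\<^sub>R d + B s \<in> U" if "s \<in> T" for s
    proof -
      have "dist x (x + t *\<^sub>R d + B s) = norm (t *\<^sub>R d + B s)"
        by (metis add.assoc add_diff_cancel_left' dist_commute dist_norm)
      then show ?thesis using step[OF that] tr r2(2) by (intro subsetD[OF r2(2)]) (simp add: r_def)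
    qed
    obtain s where s: "s \<in> T" "\<phi> s = s"
    proof (rule brouwer[of T \<phi>])
      show "compact T" unfolding T_def
        by (intro compact_Int_closed closed_subspace E) simp
      show "convex T" unfolding T_def
        by (intro convex_Int convex_cball subspace_imp_convex[OF E])
      have "0 \<in> T" using subspace_0[OF E] \<delta> t by (simp add: T_def)
      then show "T \<noteq> {}" by blast
      show "continuous_on T \<phi>" unfolding \<phi>_def
        using inU by (intro continuous_intros continuous_on_compose2[OF contf]
            linear_continuous_on linear_linear[THEN iffD1] B(1)) (auto simp: linear_linear B(1))
      show "\<phi> \<in> T \<rightarrow> T"
      proof
        fix s assume s: "s \<in> T"
        define \<rho> where "\<rho> = f (x + t *\<^sub>R d + B s) - f x - f' (t *\<^sub>R d + B s)"
        have "norm \<rho> \<le> \<delta> / (2 * L) * norm (t *\<^sub>R d + B s)"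
          using r1(2)[of "x + t *\<^sub>R d + B s"] step[OF s] tr by (simp add: \<rho>_def r_def add.assoc)
        also have "\<dots> \<le> \<delta> / (2 * L) * (t * L)"
          using step[OF s] \<delta> L by (intro mult_left_mono) auto
        also have "\<dots> = \<delta> * t / 2" using L by simp
        finally have \<rho>: "norm \<rho> \<le> \<delta> * t / 2" .
        have "f' (t *\<^sub>R d + B s) = t *\<^sub>R f' d + s"
          using s B(2) by (simp add: T_def linear_add[OF lin] linear_cmul[OF lin])
        then have \<phi>s: "\<phi> s = t *\<^sub>R ((e t - f x) /\<^sub>R t - f' d) - \<rho>"
          using t by (simp add: \<phi>_def \<rho>_def algebra_simps)
        have "norm (t *\<^sub>R ((e t - f x) /\<^sub>R t - f' d)) \<le> t * (\<delta> / 2)"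
          using elim(1) t by (simp add: dist_norm)
        then have "norm (\<phi> s) \<le> \<delta> * t"
          unfolding \<phi>s using \<rho> norm_triangle_ineq4[of "t *\<^sub>R ((e t - f x) /\<^sub>R t - f' d)" \<rho>]
          by (simp add: algebra_simps)
        moreover have "\<phi> s \<in> E"
          using s inU[OF s] fE elim(4) unfolding \<phi>_def T_def
          by (auto intro!: subspace_diff[OF E])
        ultimately show "\<phi> s \<in> T" by (simp add: T_def)
      qed
    qed blast
    show ?case
    proof (rule bexI[of _ "x + t *\<^sub>R d + B s"])
      show "norm (x + t *\<^sub>R d + B s - (x + t *\<^sub>R d)) \<le> \<epsilon> * t \<and> f (x + t *\<^sub>R d + B s) = e t"
        using Bs[OF s(1)] s(2) by (simp add: \<phi>_def)
    qed (rule inU[OF s(1)])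
  qed
qed

lemma adjoint_normal_in_regular_normal_cone:
  fixes f :: "'a::euclidean_space \<Rightarrow> 'b::euclidean_space"
  assumes der: "(f has_derivative f') (at x)" and U: "open U" "x \<in> U" and x: "x \<in> S"
    and S: "\<And>u. u \<in> U \<Longrightarrow> u \<in> S \<Longrightarrow> f u \<in> \<Xi>" and \<mu>: "\<mu> \<in> normal_cone \<Xi> (f x)"
  shows "adjoint f' \<mu> \<in> regular_normal_cone S x"
  unfolding regular_normal_cone_iff
proof (intro conjI allI impI x)
  fix \<epsilon> :: real assume \<epsilon>: "\<epsilon> > 0"
  have lin: "linear f'" using der by (rule has_derivative_linear)
  define \<delta> where "\<delta> = \<epsilon> / (norm \<mu> + 1)"
  have n1: "norm \<mu> + 1 > 0" by (simp add: add_nonneg_pos)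
  have \<delta>: "\<delta> > 0" using \<epsilon> n1 by (simp add: \<delta>_def)
  obtain r1 where r1: "r1 > 0"
    "\<And>u. norm (u - x) < r1 \<Longrightarrow> norm (f u - f x - f' (u - x)) \<le> \<delta> * norm (u - x)"
    using der \<delta> unfolding has_derivative_at_alt by metis
  obtain r2 where r2: "r2 > 0" "ball x r2 \<subseteq> U"
    using U open_contains_ball by blast
  show "\<forall>\<^sub>F u in at x within S. adjoint f' \<mu> \<bullet> (u - x) \<le> \<epsilon> * norm (u - x)"
    unfolding eventually_at
  proof (intro exI[of _ "min r1 r2"] conjI ballI impI)
    fix u assume u: "u \<in> S" "u \<noteq> x \<and> dist u x < min r1 r2"
    then have "u \<in> U" using r2(2) by (auto simp: dist_commute)
    then have le: "\<mu> \<bullet> (f u - f x) \<le> 0"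
      using normal_coneD(2)[OF \<mu> S[OF _ u(1)]] by simp
    have "adjoint f' \<mu> \<bullet> (u - x) = \<mu> \<bullet> f' (u - x)"
      using adjoint_works[OF lin, of "u - x" \<mu>] by (simp add: inner_commute)
    also have "\<dots> = \<mu> \<bullet> (f u - f x) + \<mu> \<bullet> (- (f u - f x - f' (u - x)))"
      by (simp add: inner_diff_right)
    also have "\<dots> \<le> 0 + norm \<mu> * norm (- (f u - f x - f' (u - x)))"
      by (intro add_mono le norm_cauchy_schwarz)
    also have "\<dots> \<le> norm \<mu> * (\<delta> * norm (u - x))"
      unfolding norm_minus_cancel using r1(2)[of u] u by (simp add: dist_norm mult_left_mono)
    also have "\<dots> \<le> (norm \<mu> + 1) * (\<delta> * norm (u - x))"
      using \<delta> by (intro mult_right_mono) auto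
    also have "\<dots> = \<epsilon> * norm (u - x)" using n1 by (simp add: \<delta>_def)
    finally show "adjoint f' \<mu> \<bullet> (u - x) \<le> \<epsilon> * norm (u - x)" .
  qed (use r1 r2 in auto)
qed

text \<open>Conversely, regular normals come from normals to \<open>\<Xi>\<close>, which needs the derivative to be onto \<open>E\<close>. Every direction \<open>d\<close> whose image
  \<open>f' d\<close> points from \<open>f x\<close> to a point of \<open>\<Xi>\<close> is tangent to the preimage, by lifting the segment, so a
  regular normal \<open>w\<close> satisfies \<open>w \<bullet> d \<le> 0\<close>. For \<open>f' d = 0\<close> this makes \<open>w\<close> vanish on the kernel,
  hence \<open>w\<close> is in the range of the adjoint; the other directions show that a vector of
  \<open>E\<close> mapped to \<open>w\<close> by the adjoint is normal to \<open>\<Xi>\<close>.\<close>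

lemma regular_normal_cone_subset_adjoint_normals:
  fixes f :: "'a::euclidean_space \<Rightarrow> 'b::euclidean_space"
  assumes der: "(f has_derivative f') (at x)" and U: "open U" "x \<in> U" and contf: "continuous_on U f"
    and fE: "f ` U \<subseteq> E" and E: "subspace E" and rng: "range f' = E" and \<Xi>: "\<Xi> \<subseteq> E" "convex \<Xi>"
    and S: "\<And>u. u \<in> U \<Longrightarrow> u \<in> S \<longleftrightarrow> f u \<in> \<Xi>" and w: "w \<in> regular_normal_cone S x"
  shows "\<exists>\<mu>\<in>E \<inter> normal_cone \<Xi> (f x). w = adjoint f' \<mu>"
proof -
  have lin: "linear f'" using der by (rule has_derivative_linear)
  have x: "x \<in> S" using w by (simp add: regular_normal_cone_iff)
  then have fx: "f x \<in> \<Xi>" using S U by simp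
  have key: "w \<bullet> d \<le> 0" if c: "c \<in> \<Xi>" and d: "f' d = c - f x" for c d
  proof (rule ccontr)
    assume "\<not> w \<bullet> d \<le> 0"
    then have wd: "w \<bullet> d > 0" by simp
    \<comment> \<open>Along lifted points the normality of \<open>w\<close> gives \<open>w \<bullet> d \<le> \<epsilon> * N\<close>, which is at most half of
      \<open>w \<bullet> d\<close> for the \<open>\<epsilon>\<close> chosen here.\<close>
    define N where "N = norm w + norm d + 1"
    have N: "N > 0" by (simp add: N_def add_nonneg_pos)
    define \<epsilon> where "\<epsilon> = min 1 (w \<bullet> d / (2 * N))"
    have \<epsilon>: "0 < \<epsilon>" "\<epsilon> \<le> 1" using wd N by (auto simp: \<epsilon>_def)
    obtain r where r: "r > 0"
      "\<And>u. u \<in> S \<Longrightarrow> u \<noteq> x \<Longrightarrow> dist u x < r \<Longrightarrow> w \<bullet> (u - x) \<le> \<epsilon> * norm (u - x)"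
      using w \<epsilon>(1) unfolding regular_normal_cone_iff eventually_at by blast
    define e where "e t = f x + t *\<^sub>R (c - f x)" for t
    have pos: "\<forall>\<^sub>F t in at_right 0. 0 < (t::real)" by (rule eventually_at_right_less)
    have lt1: "\<forall>\<^sub>F t in at_right 0. (t::real) < 1"
      by (intro eventually_at_right_real[of 0 "1::real", THEN eventually_mono]) auto
    have e\<Xi>: "\<forall>\<^sub>F t in at_right 0. e t \<in> \<Xi>"
      using pos lt1
    proof eventually_elim
      case (elim t)
      have "e t = (1 - t) *\<^sub>R f x + t *\<^sub>R c" by (simp add: e_def algebra_simps)
      then show ?case using convexD_alt[OF \<Xi>(2) fx c, of t] elim by simp
    qed
    have eE: "\<forall>\<^sub>F t in at_right 0. e t \<in> E"
      using e\<Xi> by eventually_elim (use \<Xi> in blast)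
    have elim': "((\<lambda>t. (e t - f x) /\<^sub>R t) \<longlongrightarrow> f' d) (at_right 0)"
      by (rule tendsto_eventually) (use pos in eventually_elim, simp add: e_def d)
    have "\<forall>\<^sub>F t in at_right 0. t < r / N"
      using r N by (intro eventually_at_right_real[of 0 "r / N", THEN eventually_mono]) auto
    with solve_along_direction[OF der U contf fE E rng eE elim' \<epsilon>(1)] pos e\<Xi>
    have "\<forall>\<^sub>F t in at_right (0::real). False"
    proof eventually_elim
      case (elim t)
      then obtain u where u: "u \<in> U" "norm (u - (x + t *\<^sub>R d)) \<le> \<epsilon> * t" "f u = e t" by blast
      have t: "t > 0" "t * N < r" using elim N by (simp_all add: field_simps)
      have uS: "u \<in> S" using S[OF u(1)] u(3) elim by simp
      have n: "norm (u - x) \<le> t * (norm d + \<epsilon>)"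
        using norm_triangle_ineq[of "u - (x + t *\<^sub>R d)" "t *\<^sub>R d"] u(2) t by (simp add: algebra_simps)
      have "\<epsilon> \<le> norm w + 1" using \<epsilon> norm_ge_zero[of w] by linarith
      then have "t * (norm d + \<epsilon>) \<le> t * N"
        using t by (intro mult_left_mono) (simp_all add: N_def)
      with n t have "norm (u - x) < r" by linarith
      then have "dist u x < r" by (simp add: dist_norm)
      then have "w \<bullet> (u - x) \<le> \<epsilon> * norm (u - x)"
        using r(2)[OF uS] by (cases "u = x") auto
      also have "\<dots> \<le> \<epsilon> * (t * (norm d + 1))"
      proof (intro mult_left_mono)
        show "norm (u - x) \<le> t * (norm d + 1)"
          by (rule order_trans[OF n]) (use t \<epsilon> in \<open>simp add: mult_left_mono\<close>)
      qed (use \<epsilon> in simp)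
      finally have 1: "w \<bullet> (u - x) \<le> \<epsilon> * (t * (norm d + 1))" .
      have "- (w \<bullet> (u - (x + t *\<^sub>R d))) \<le> norm w * (\<epsilon> * t)"
        using norm_cauchy_schwarz[of "w" "- (u - (x + t *\<^sub>R d))"] mult_left_mono[OF u(2), of "norm w"]
        unfolding norm_minus_cancel inner_minus_right by simp
      with 1 have "t * (w \<bullet> d) \<le> t * (\<epsilon> * N)"
        by (simp add: N_def algebra_simps)
      then have "w \<bullet> d \<le> \<epsilon> * N" using t by simp
      also have "\<dots> \<le> w \<bullet> d / (2 * N) * N" using N by (intro mult_right_mono) (auto simp: \<epsilon>_def)
      also have "\<dots> = w \<bullet> d / 2" using N by simp
      finally show False using wd by simp
    qed
    then show False by simp
  qed
  obtain B where B: "linear B" "\<And>s. s \<in> E \<Longrightarrow> f' (B s) = s"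
    using linear_exists_right_inverse_on[OF lin subspace_UNIV] rng by blast
  obtain \<mu> \<mu>' where \<mu>: "\<mu> \<in> E" "\<And>s. s \<in> E \<Longrightarrow> orthogonal \<mu>' s" "adjoint B w = \<mu> + \<mu>'"
    using orthogonal_subspace_decomp_exists[of E "adjoint B w"] span_eq_iff[THEN iffD2, OF E] by metis
  have ker: "w \<bullet> d = 0" if "f' d = 0" for d
    using key[OF fx, of d] key[OF fx, of "- d"] that linear_neg[OF lin, of d] by simp
  have w\<mu>: "w \<bullet> d = \<mu> \<bullet> f' d" for d
  proof -
    have fd: "f' d \<in> E" using rng by auto
    have "f' (d - B (f' d)) = 0" by (simp add: linear_diff[OF lin] B(2)[OF fd])
    then have "w \<bullet> d = w \<bullet> B (f' d)" using ker by (fastforce simp: inner_diff_right)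
    also have "\<dots> = adjoint B w \<bullet> f' d" using adjoint_works[OF B(1), of "f' d" w] by (simp add: inner_commute)
    also have "\<dots> = \<mu> \<bullet> f' d" using \<mu>(2)[OF fd] by (simp add: \<mu>(3) inner_add_left orthogonal_def)
    finally show ?thesis .
  qed
  have "d \<bullet> w = d \<bullet> adjoint f' \<mu>" for d
    using w\<mu>[of d] by (simp add: adjoint_works[OF lin] inner_commute)
  then have "w = adjoint f' \<mu>" using vector_eq_ldot by blast
  moreover have "\<mu> \<in> normal_cone \<Xi> (f x)"
  proof (rule normal_coneI[OF fx])
    fix c assume c: "c \<in> \<Xi>"
    then have "c - f x \<in> range f'" using \<Xi> fx by (simp add: rng subspace_diff[OF E] subset_iff)
    then obtain d where "f' d = c - f x" by force
    then show "\<mu> \<bullet> (c - f x) \<le> 0" using key[OF c] w\<mu> by metis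
  qed
  ultimately show ?thesis using \<mu>(1) by blast
qed

text \<open>If the derivative is onto \<open>E\<close> at \<open>x0\<close>, the description of the regular normals through
  multipliers holds on a whole neighbourhood, with multipliers bounded by the normals they represent.\<close>

lemma regular_normal_cone_reduction:
  fixes f :: "'a::euclidean_space \<Rightarrow> 'b::euclidean_space" and f' :: "'a \<Rightarrow> 'a \<Rightarrow>\<^sub>L 'b"
  assumes der: "\<And>x. x \<in> U \<Longrightarrow> (f has_derivative f' x) (at x)" and contf': "isCont f' x0"
    and U: "open U" "x0 \<in> U" and fE: "f ` U \<subseteq> E" and E: "subspace E"
    and rng: "range (f' x0) = E" and \<Xi>: "\<Xi> \<subseteq> E" "convex \<Xi>"
    and S: "\<And>u. u \<in> U \<Longrightarrow> u \<in> S \<longleftrightarrow> f u \<in> \<Xi>"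
  shows "\<exists>M W. 0 < M \<and> open W \<and> x0 \<in> W \<and> W \<subseteq> U \<and>
    (\<forall>x\<in>W. (\<forall>\<mu>\<in>E. norm \<mu> \<le> M * norm (adjoint (f' x) \<mu>)) \<and>
      regular_normal_cone S x = adjoint (f' x) ` (E \<inter> normal_cone \<Xi> (f x)))"
proof -
  obtain M \<delta> where M: "M > 0" "\<delta> > 0"
    "\<And>B \<mu>. norm (B - f' x0) < \<delta> \<Longrightarrow> \<mu> \<in> E \<Longrightarrow> norm \<mu> \<le> M * norm (adjoint B \<mu>)"
    using adjoint_bounded_below_near[OF rng] by metis
  obtain r where r: "r > 0" "\<And>x. dist x x0 < r \<Longrightarrow> dist (f' x) (f' x0) < \<delta>"
    using contf' M(2) unfolding continuous_at_eps_delta by blast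
  have cont: "continuous_on U f"
    using der by (meson continuous_at_imp_continuous_on has_derivative_continuous)
  show ?thesis
  proof (intro exI[of _ M] exI[of _ "U \<inter> ball x0 r"] conjI ballI)
    have bnd: "norm \<mu> \<le> M * norm (adjoint (f' x) \<mu>)" if "x \<in> U \<inter> ball x0 r" "\<mu> \<in> E" for x \<mu>
    proof (rule M(3)[OF _ that(2)])
      show "norm (f' x - f' x0) < \<delta>"
        using r(2)[of x] that(1) by (simp add: dist_commute dist_norm[symmetric])
    qed
    fix x assume x: "x \<in> U \<inter> ball x0 r"
    show "norm \<mu> \<le> M * norm (adjoint (f' x) \<mu>)" if "\<mu> \<in> E" for \<mu>
      using bnd[OF x that] .
    have xU: "x \<in> U" using x by simp
    have "range (f' x) \<subseteq> E" by (rule derivative_in_subspace[OF der[OF xU] U(1) xU fE E])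
    then have rngx: "range (f' x) = E"
      using range_eq_if_adjoint_bounded_below[OF E] bnd[OF x] by blast
    show "regular_normal_cone S x = adjoint (f' x) ` (E \<inter> normal_cone \<Xi> (f x))"
    proof (intro equalityI subsetI)
      fix w assume "w \<in> regular_normal_cone S x"
      from regular_normal_cone_subset_adjoint_normals[OF der[OF xU] U(1) xU cont fE E rngx \<Xi> S this]
      show "w \<in> adjoint (f' x) ` (E \<inter> normal_cone \<Xi> (f x))" by blast
    next
      fix w assume "w \<in> adjoint (f' x) ` (E \<inter> normal_cone \<Xi> (f x))"
      then obtain \<mu> where \<mu>: "w = adjoint (f' x) \<mu>" "\<mu> \<in> normal_cone \<Xi> (f x)" by blast
      have "x \<in> S" using S[OF xU] normal_coneD(1)[OF \<mu>(2)] by simp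
      from adjoint_normal_in_regular_normal_cone[OF der[OF xU] U(1) xU this _ \<mu>(2)] S
      show "w \<in> regular_normal_cone S x" unfolding \<mu>(1) by blast
    qed
  qed (use M U r in auto)
qed

section \<open>The graphical derivative of the normal cone mapping\<close>

text \<open>The setting of the second-order analysis, on Euclidean spaces and with derivatives as bounded
  linear maps. The convex set \<open>\<Theta>\<close> is described near \<open>g y\<close> by \<open>\<eta> z \<in> \<Xi>\<close>. Nondegeneracy enters only
  through \<open>surj\<close>: the derivative of \<open>\<eta> \<circ> g\<close> at \<open>y\<close> is onto the subspace \<open>E\<close> that contains \<open>\<Xi>\<close>. Second
  derivatives are needed only at the reference points \<open>y\<close> and \<open>g y\<close>.\<close>

locale nondegenerate_reduction =
  fixes g :: "'a::euclidean_space \<Rightarrow> 'b::euclidean_space" and g' :: "'a \<Rightarrow> 'a \<Rightarrow>\<^sub>L 'b"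
    and g'' :: "'a \<Rightarrow> 'a \<Rightarrow>\<^sub>L 'b" and y :: 'a and \<Theta> :: "'b set"
    and \<eta> :: "'b \<Rightarrow> 'c::euclidean_space" and \<eta>' :: "'b \<Rightarrow> 'b \<Rightarrow>\<^sub>L 'c"
    and \<eta>'' :: "'b \<Rightarrow> 'b \<Rightarrow>\<^sub>L 'c" and V :: "'b set" and E \<Xi> :: "'c set"
  assumes der_g: "(g has_derivative g' x) (at x)"
    and der_g': "(g' has_derivative g'') (at y)"
    and \<Theta>: "closed \<Theta>" "convex \<Theta>" and y: "g y \<in> \<Theta>"
    and V: "open V" "g y \<in> V"
    and der_\<eta>: "z \<in> V \<Longrightarrow> (\<eta> has_derivative \<eta>' z) (at z)"
    and der_\<eta>': "(\<eta>' has_derivative \<eta>'') (at (g y))"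
    and \<eta>E: "\<eta> ` V \<subseteq> E" and E: "subspace E" and \<Xi>: "\<Xi> \<subseteq> E" "convex \<Xi>"
    and reduction: "z \<in> V \<Longrightarrow> z \<in> \<Theta> \<longleftrightarrow> \<eta> z \<in> \<Xi>"
    and surj: "range (\<eta>' (g y) o\<^sub>L g' y) = E"
begin

abbreviation "U \<equiv> g -` V"
abbreviation "\<Gamma> \<equiv> g -` \<Theta>"

text \<open>The reduced constraint map: near \<open>y\<close> the feasible set \<open>\<Gamma>\<close> is the preimage of \<open>\<Xi>\<close> under \<open>F\<close>.\<close>

definition "F = \<eta> \<circ> g"

text \<open>The derivative of \<open>F\<close> at \<open>x\<close>, by the chain rule.\<close>

definition "F' x = \<eta>' (g x) o\<^sub>L g' x"

text \<open>The derivative at \<open>y\<close>, in direction \<open>h\<close>, of the derivative of \<open>F\<close>.\<close>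

definition "F'' h = (\<eta>' (g y) o\<^sub>L g'' h) + (\<eta>'' (g' y h) o\<^sub>L g' y)"

lemma U: "open U" "y \<in> U"
proof -
  have "continuous_on UNIV g"
    using der_g by (meson continuous_at_imp_continuous_on has_derivative_continuous)
  then show "open U" by (rule open_vimage[OF V(1)])
  show "y \<in> U" using V(2) by simp
qed

lemma der_F: "x \<in> U \<Longrightarrow> (F has_derivative F' x) (at x)"
  using diff_chain_at[OF der_g der_\<eta>, of x] by (simp add: F_def F'_def o_def blinfun_compose.rep_eq)

lemma der_F': "(F' has_derivative F'') (at y)"
proof -
  have "((\<lambda>x. \<eta>' (g x)) has_derivative (\<lambda>h. \<eta>'' (g' y h))) (at y)"
    using diff_chain_at[OF der_g der_\<eta>'] by (simp add: o_def)
  from bounded_bilinear.FDERIV[OF bounded_bilinear_blinfun_compose this der_g']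
  show ?thesis by (simp add: F'_def[abs_def] F''_def[abs_def])
qed

lemma adjoint_F': "adjoint (F' x) \<mu> = adjoint (g' x) (adjoint (\<eta>' (g x)) \<mu>)"
  by (simp add: F'_def adjoint_blinfun_compose)

lemma F_range: "F ` U \<subseteq> E" "range (F' y) = E"
  using \<eta>E surj by (auto simp: F_def F'_def)

lemma F_reduction: "x \<in> U \<Longrightarrow> x \<in> \<Gamma> \<longleftrightarrow> F x \<in> \<Xi>"
  using reduction by (simp add: F_def)

lemma range_\<eta>': "range (\<eta>' (g y)) = E"
proof
  show "range (\<eta>' (g y)) \<subseteq> E"
    by (rule derivative_in_subspace[OF der_\<eta>[OF V(2)] V \<eta>E E])
  show "E \<subseteq> range (\<eta>' (g y))" unfolding surj[symmetric] by auto
qed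

lemma \<Theta>_normals:
  "\<exists>M W. 0 < M \<and> open W \<and> g y \<in> W \<and> W \<subseteq> V \<and>
    (\<forall>z\<in>W. (\<forall>\<mu>\<in>E. norm \<mu> \<le> M * norm (adjoint (\<eta>' z) \<mu>)) \<and>
      normal_cone \<Theta> z = adjoint (\<eta>' z) ` (E \<inter> normal_cone \<Xi> (\<eta> z)))"
  using regular_normal_cone_reduction[where f = \<eta> and f' = \<eta>' and S = \<Theta>,
      OF der_\<eta> has_derivative_continuous[OF der_\<eta>'] V \<eta>E E range_\<eta>' \<Xi> reduction]
  unfolding regular_normal_cone_convex[OF \<Theta>(2)] .

lemma \<Gamma>_normals:
  "\<exists>M W. 0 < M \<and> open W \<and> y \<in> W \<and> W \<subseteq> U \<and>
    (\<forall>x\<in>W. (\<forall>\<mu>\<in>E. norm \<mu> \<le> M * norm (adjoint (F' x) \<mu>)) \<and>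
      regular_normal_cone \<Gamma> x = adjoint (F' x) ` (E \<inter> normal_cone \<Xi> (F x)))"
  using regular_normal_cone_reduction[where f = F and f' = F' and S = \<Gamma>,
      OF der_F has_derivative_continuous[OF der_F'] U F_range(1) E F_range(2) \<Xi> F_reduction] .

lemma unique_multiplier:
  assumes "w \<in> regular_normal_cone \<Gamma> y"
  shows "\<exists>!\<nu>. \<nu> \<in> normal_cone \<Theta> (g y) \<and> w = adjoint (g' y) \<nu>"
proof -
  have N\<Theta>: "normal_cone \<Theta> (g y) = adjoint (\<eta>' (g y)) ` (E \<inter> normal_cone \<Xi> (F y))"
    using \<Theta>_normals unfolding F_def o_def by blast
  have N\<Gamma>: "regular_normal_cone \<Gamma> y = adjoint (F' y) ` (E \<inter> normal_cone \<Xi> (F y))"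
    using \<Gamma>_normals by blast
  obtain C where C: "linear C" "\<And>\<mu>. \<mu> \<in> E \<Longrightarrow> C (adjoint (F' y) \<mu>) = \<mu>"
    using adjoint_left_inverse_on_range[OF F_range(2)] by blast
  obtain \<mu> where \<mu>: "\<mu> \<in> E \<inter> normal_cone \<Xi> (F y)" "w = adjoint (F' y) \<mu>"
    using assms unfolding N\<Gamma> by blast
  show ?thesis
  proof (rule ex1I[of _ "adjoint (\<eta>' (g y)) \<mu>"])
    show "adjoint (\<eta>' (g y)) \<mu> \<in> normal_cone \<Theta> (g y) \<and> w = adjoint (g' y) (adjoint (\<eta>' (g y)) \<mu>)"
      using \<mu> by (auto simp: N\<Theta> adjoint_F')
    fix \<nu> assume "\<nu> \<in> normal_cone \<Theta> (g y) \<and> w = adjoint (g' y) \<nu>"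
    then obtain \<mu>' where \<mu>': "\<mu>' \<in> E" "\<nu> = adjoint (\<eta>' (g y)) \<mu>'" "w = adjoint (F' y) \<mu>'"
      unfolding N\<Theta> by (auto simp: adjoint_F')
    have "\<mu>' = C w" using C(2)[OF \<mu>'(1)] unfolding \<mu>'(3) by simp
    moreover have "\<mu> = C w" using C(2)[of \<mu>] \<mu>(1) unfolding \<mu>(2) by simp
    ultimately show "\<nu> = adjoint (\<eta>' (g y)) \<mu>" using \<mu>'(2) by simp
  qed
qed

lemma critical_cone_properties:
  "closed (critical_cone \<Theta> (g y) \<nu>)" "convex (critical_cone \<Theta> (g y) \<nu>)"
  "critical_cone \<Theta> (g y) \<nu> \<noteq> {}"
proof -
  have sub: "subspace (orthogonal_comp {\<nu>})" by (rule subspace_orthogonal_comp)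
  show "closed (critical_cone \<Theta> (g y) \<nu>)" "convex (critical_cone \<Theta> (g y) \<nu>)"
    unfolding critical_cone_def
    using closed_tangent_cone_convex[OF \<Theta>(2) y] convex_tangent_cone[OF \<Theta>(2) y]
      closed_subspace[OF sub] subspace_imp_convex[OF sub] by (auto intro: convex_Int)
  show "critical_cone \<Theta> (g y) \<nu> \<noteq> {}"
    unfolding critical_cone_def using zero_in_tangent_cone[OF y] subspace_0[OF sub] by blast
qed

lemma closest_point_\<Theta>_iff: "closest_point \<Theta> x = z \<longleftrightarrow> x - z \<in> normal_cone \<Theta> z"
  using closest_point_eq_iff_normal_cone[OF \<Theta>(2,1)] y by blast

lemma closest_point_\<Theta>_lipschitz: "dist (closest_point \<Theta> a) (closest_point \<Theta> b) \<le> dist a b"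
  using closest_point_lipschitz[OF \<Theta>(2,1)] y by blast

text \<open>Normals \<open>q k\<close> at points \<open>x k\<close> have multipliers \<open>\<mu> k\<close> for \<open>\<Xi>\<close>, and hence multipliers \<open>\<nu>' k\<close> for
  \<open>\<Theta>\<close>. The left inverse of the adjoint of \<open>F' y\<close> transfers convergence of the difference quotients
  from \<open>q\<close> to \<open>\<mu>\<close> and then to \<open>\<nu>'\<close>; their limit is \<open>n\<close>. As \<open>g (x k)\<close> is the projection of
  \<open>g (x k) + \<nu>' k\<close>, differentiating the projection shows that \<open>g' y v\<close> is the projection of
  \<open>g' y v + n\<close> onto the critical cone, that is, \<open>n\<close> is normal to that cone at \<open>g' y v\<close>.\<close>

lemma graphical_derivative_subset:
  assumes \<nu>: "\<nu> \<in> normal_cone \<Theta> (g y)"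
    and PDC: "\<And>h. has_dir_derivative (closest_point \<Theta>) (g y + \<nu>) h
      (closest_point (critical_cone \<Theta> (g y) \<nu>) h)"
    and w: "w \<in> graphical_derivative (regular_normal_cone \<Gamma>) y (adjoint (g' y) \<nu>) v"
  shows "\<exists>n\<in>normal_cone (critical_cone \<Theta> (g y) \<nu>) (g' y v).
    w = adjoint (g'' v) \<nu> + adjoint (g' y) n"
proof -
  define w0 where "w0 = adjoint (g' y) \<nu>"
  obtain t :: "nat \<Rightarrow> real" and p where t: "\<And>k. t k > 0" "t \<longlonglongrightarrow> 0" and p: "p \<longlonglongrightarrow> (v, w)"
    and pin: "\<And>k. (y, w0) + t k *\<^sub>R p k \<in> {(x', y'). y' \<in> regular_normal_cone \<Gamma> x'}"
    using w unfolding graphical_derivative_def tangent_cone_def w0_def by blast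
  have tpos: "\<forall>\<^sub>F k in sequentially. 0 < t k" using t(1) by simp
  define x where "x k = y + t k *\<^sub>R fst (p k)" for k
  define q where "q k = w0 + t k *\<^sub>R snd (p k)" for k
  have q: "q k \<in> regular_normal_cone \<Gamma> (x k)" for k
    using pin[of k] by (cases "p k") (simp add: x_def q_def)
  have xq: "(\<lambda>k. (x k - y) /\<^sub>R t k) \<longlonglongrightarrow> v"
    using tendsto_fst[OF p] t(1) by (simp add: x_def less_imp_neq[symmetric])
  have qq: "(\<lambda>k. (q k - w0) /\<^sub>R t k) \<longlonglongrightarrow> w"
    using tendsto_snd[OF p] t(1) by (simp add: q_def less_imp_neq[symmetric])
  have x0: "x \<longlonglongrightarrow> y" and gq: "(\<lambda>k. (g (x k) - g y) /\<^sub>R t k) \<longlonglongrightarrow> g' y v"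
    using tendsto_difference_quotient[OF der_g t(2) tpos xq] by blast+
  have q0: "q \<longlonglongrightarrow> w0"
    by (rule tendsto_difference_quotient(1)[OF has_derivative_ident t(2) tpos qq])
  have F'q: "(\<lambda>k. (F' (x k) - F' y) /\<^sub>R t k) \<longlonglongrightarrow> F'' v"
    by (rule tendsto_difference_quotient(2)[OF der_F' t(2) tpos xq])
  have F'0: "(\<lambda>k. F' (x k)) \<longlonglongrightarrow> F' y"
    by (rule tendsto_difference_quotient(1)[OF has_derivative_ident t(2) tpos F'q])
  have g'q: "(\<lambda>k. (g' (x k) - g' y) /\<^sub>R t k) \<longlonglongrightarrow> g'' v"
    by (rule tendsto_difference_quotient(2)[OF der_g' t(2) tpos xq])
  have \<eta>'q: "(\<lambda>k. (\<eta>' (g (x k)) - \<eta>' (g y)) /\<^sub>R t k) \<longlonglongrightarrow> \<eta>'' (g' y v)"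
    by (rule tendsto_difference_quotient(2)[OF der_\<eta>' t(2) tpos gq])
  obtain M W where W: "M > 0" "open W" "y \<in> W" "W \<subseteq> U"
    and W_normals: "\<forall>x\<in>W. (\<forall>\<mu>\<in>E. norm \<mu> \<le> M * norm (adjoint (F' x) \<mu>)) \<and>
      regular_normal_cone \<Gamma> x = adjoint (F' x) ` (E \<inter> normal_cone \<Xi> (F x))"
    using \<Gamma>_normals by blast
  have xW: "\<forall>\<^sub>F k in sequentially. x k \<in> W"
    using topological_tendstoD[OF x0 W(2,3)] .
  have "\<forall>k. \<exists>\<mu>. x k \<in> W \<longrightarrow> \<mu> \<in> E \<inter> normal_cone \<Xi> (F (x k)) \<and> q k = adjoint (F' (x k)) \<mu>"
    using q W_normals by blast
  then obtain \<mu> where \<mu>: "\<And>k. x k \<in> W \<Longrightarrow> \<mu> k \<in> E \<inter> normal_cone \<Xi> (F (x k))"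
    "\<And>k. x k \<in> W \<Longrightarrow> q k = adjoint (F' (x k)) (\<mu> k)"
    by metis
  obtain \<mu>0 where \<mu>0: "\<mu>0 \<in> E" "\<nu> = adjoint (\<eta>' (g y)) \<mu>0"
    using \<nu> \<Theta>_normals by blast
  have w0: "w0 = adjoint (F' y) \<mu>0" by (simp add: w0_def \<mu>0 adjoint_F')
  obtain C where C: "linear C" "\<And>\<mu>. \<mu> \<in> E \<Longrightarrow> C (adjoint (F' y) \<mu>) = \<mu>"
    using adjoint_left_inverse_on_range[OF F_range(2)] by blast
  have Clim: "((\<lambda>k. C (a k)) \<longlonglongrightarrow> C b)" if "a \<longlonglongrightarrow> b" for a b
    using bounded_linear.tendsto[OF _ that] C(1) by (simp add: linear_linear)
  have \<mu>lim: "\<mu> \<longlonglongrightarrow> \<mu>0"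
  proof -
    have "(\<lambda>k. adjoint (F' (x k) - F' y) (\<mu> k)) \<longlonglongrightarrow> 0"
    proof (rule Lim_null_comparison)
      show "\<forall>\<^sub>F k in sequentially.
          norm (adjoint (F' (x k) - F' y) (\<mu> k)) \<le> norm (F' (x k) - F' y) * (M * norm (q k))"
        using xW
      proof eventually_elim
        case (elim k)
        have "norm (\<mu> k) \<le> M * norm (q k)"
          using bspec[OF W_normals elim] \<mu>[OF elim] by simp
        then show ?case
          by (rule order_trans[OF norm_adjoint_le mult_left_mono]) simp
      qed
      have "(\<lambda>k. norm (F' (x k) - F' y) * (M * norm (q k))) \<longlonglongrightarrow> norm (F' y - F' y) * (M * norm w0)"
        by (intro tendsto_intros F'0 q0)
      then show "(\<lambda>k. norm (F' (x k) - F' y) * (M * norm (q k))) \<longlonglongrightarrow> 0" by simp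
    qed
    from Clim[OF tendsto_diff[OF q0 this]]
    have lim: "(\<lambda>k. C (q k - adjoint (F' (x k) - F' y) (\<mu> k))) \<longlonglongrightarrow> \<mu>0"
      using C(2)[OF \<mu>0(1)] by (simp add: w0)
    have "\<forall>\<^sub>F k in sequentially. C (q k - adjoint (F' (x k) - F' y) (\<mu> k)) = \<mu> k"
      using xW
    proof eventually_elim
      case (elim k)
      have "q k - adjoint (F' (x k) - F' y) (\<mu> k) = adjoint (F' y) (\<mu> k)"
        by (simp add: \<mu>(2)[OF elim] adjoint_blinfun_diff_left)
      then show ?case using C(2) \<mu>(1)[OF elim] by simp
    qed
    from Lim_transform_eventually[OF lim this] show ?thesis .
  qed
  define m where "m = C (w - adjoint (F'' v) \<mu>0)"
  have \<mu>q: "(\<lambda>k. (\<mu> k - \<mu>0) /\<^sub>R t k) \<longlonglongrightarrow> m"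
  proof -
    have lim: "(\<lambda>k. C ((q k - w0) /\<^sub>R t k - adjoint ((F' (x k) - F' y) /\<^sub>R t k) (\<mu> k))) \<longlonglongrightarrow> m"
      unfolding m_def by (intro Clim tendsto_diff qq tendsto_adjoint F'q \<mu>lim)
    have "\<forall>\<^sub>F k in sequentially.
        C ((q k - w0) /\<^sub>R t k - adjoint ((F' (x k) - F' y) /\<^sub>R t k) (\<mu> k)) = (\<mu> k - \<mu>0) /\<^sub>R t k"
      using xW
    proof eventually_elim
      case (elim k)
      have "(q k - w0) /\<^sub>R t k - adjoint ((F' (x k) - F' y) /\<^sub>R t k) (\<mu> k)
          = adjoint (F' y) ((\<mu> k - \<mu>0) /\<^sub>R t k)"
        by (simp add: \<mu>(2)[OF elim] w0 adjoint_blinfun_diff_left adjoint_blinfun_diff_right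
            adjoint_blinfun_scaleR_left adjoint_blinfun_scaleR_right scaleR_diff_right)
      moreover have "(\<mu> k - \<mu>0) /\<^sub>R t k \<in> E"
        using \<mu>(1)[OF elim] \<mu>0(1) by (intro subspace_scale[OF E] subspace_diff[OF E]) auto
      ultimately show ?case using C(2) by simp
    qed
    from Lim_transform_eventually[OF lim this] show ?thesis .
  qed
  define \<nu>' where "\<nu>' k = adjoint (\<eta>' (g (x k))) (\<mu> k)" for k
  define n where "n = adjoint (\<eta>'' (g' y v)) \<mu>0 + adjoint (\<eta>' (g y)) m"
  have \<nu>q: "(\<lambda>k. (\<nu>' k - \<nu>) /\<^sub>R t k) \<longlonglongrightarrow> n"
    unfolding \<nu>'_def n_def \<mu>0(2)
    by (rule tendsto_adjoint_difference_quotient[OF t(2) tpos \<eta>'q \<mu>q])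
  have "\<forall>\<^sub>F k in sequentially. (q k - w0) /\<^sub>R t k
      = (adjoint (g' (x k)) (\<nu>' k) - adjoint (g' y) \<nu>) /\<^sub>R t k"
    using xW by eventually_elim (simp add: \<mu>(2) w0_def \<nu>'_def adjoint_F')
  from Lim_transform_eventually[OF qq this]
    tendsto_adjoint_difference_quotient[OF t(2) tpos g'q \<nu>q]
  have w_eq: "w = adjoint (g'' v) \<nu> + adjoint (g' y) n"
    by (rule LIMSEQ_unique)
  have normal: "\<forall>\<^sub>F k in sequentially. closest_point \<Theta> (g (x k) + \<nu>' k) = g (x k)"
    using xW
  proof eventually_elim
    case (elim k)
    have V': "g (x k) \<in> V" using elim W(4) by auto
    have "\<eta> (g (x k)) \<in> \<Xi>"
      using normal_coneD(1) \<mu>(1)[OF elim] by (fastforce simp: F_def)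
    then have "g (x k) \<in> \<Theta>" using reduction[OF V'] by simp
    moreover have "\<mu> k \<in> normal_cone \<Xi> (\<eta> (g (x k)))"
      using \<mu>(1)[OF elim] by (simp add: F_def)
    ultimately have "\<nu>' k \<in> regular_normal_cone \<Theta> (g (x k))"
      unfolding \<nu>'_def
      using adjoint_normal_in_regular_normal_cone[OF der_\<eta>[OF V'] V(1) V'] reduction by blast
    then show ?case
      by (simp add: closest_point_\<Theta>_iff regular_normal_cone_convex[OF \<Theta>(2)])
  qed
  have base: "closest_point \<Theta> (g y + \<nu>) = g y"
    using \<nu> by (simp add: closest_point_\<Theta>_iff)
  have "(\<lambda>k. (g (x k) + \<nu>' k - (g y + \<nu>)) /\<^sub>R t k) \<longlonglongrightarrow> g' y v + n"
    using tendsto_add[OF gq \<nu>q] by (simp add: algebra_simps)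
  from tendsto_directional_difference_quotient[OF PDC closest_point_\<Theta>_lipschitz t(2) tpos this]
  have lim: "(\<lambda>k. (closest_point \<Theta> (g (x k) + \<nu>' k) - g y) /\<^sub>R t k)
      \<longlonglongrightarrow> closest_point (critical_cone \<Theta> (g y) \<nu>) (g' y v + n)"
    unfolding base .
  have "\<forall>\<^sub>F k in sequentially. (closest_point \<Theta> (g (x k) + \<nu>' k) - g y) /\<^sub>R t k
      = (g (x k) - g y) /\<^sub>R t k"
    using normal by eventually_elim simp
  from Lim_transform_eventually[OF lim this] gq
  have "closest_point (critical_cone \<Theta> (g y) \<nu>) (g' y v + n) = g' y v"
    by (rule LIMSEQ_unique)
  then have "g' y v + n - g' y v \<in> normal_cone (critical_cone \<Theta> (g y) \<nu>) (g' y v)"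
    unfolding closest_point_eq_iff_normal_cone[OF critical_cone_properties(2,1,3)] .
  then have "n \<in> normal_cone (critical_cone \<Theta> (g y) \<nu>) (g' y v)"
    by simp
  then show ?thesis using w_eq by blast
qed

text \<open>Projecting \<open>g y + \<nu> + s *\<^sub>R h\<close> with \<open>h = g' y v + n\<close> onto \<open>\<Theta>\<close> gives points \<open>z s\<close> with normals
  \<open>\<nu>' s\<close> that move with velocities \<open>g' y v\<close> and \<open>n\<close>. The points \<open>z s\<close> need not lie in the range of \<open>g\<close>, but
  their reductions \<open>\<eta> (z s)\<close> can be lifted through \<open>F\<close>. The multiplier \<open>\<mu>\<close> for \<open>\<Xi>\<close> is kept, and
  passing from \<open>z s\<close> to \<open>g (x k)\<close> changes the multiplier for \<open>\<Theta>\<close> by \<open>o(s)\<close> only, because \<open>\<eta>'\<close> is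
  differentiable at \<open>g y\<close> and both points have the same velocity.\<close>

lemma graphical_derivative_superset:
  assumes \<nu>: "\<nu> \<in> normal_cone \<Theta> (g y)"
    and PDC: "\<And>h. has_dir_derivative (closest_point \<Theta>) (g y + \<nu>) h
      (closest_point (critical_cone \<Theta> (g y) \<nu>) h)"
    and n: "n \<in> normal_cone (critical_cone \<Theta> (g y) \<nu>) (g' y v)"
  shows "adjoint (g'' v) \<nu> + adjoint (g' y) n
    \<in> graphical_derivative (regular_normal_cone \<Gamma>) y (adjoint (g' y) \<nu>) v"
proof -
  define h where "h = g' y v + n"
  define z where "z s = closest_point \<Theta> (g y + \<nu> + s *\<^sub>R h)" for s
  define \<nu>' where "\<nu>' s = g y + \<nu> + s *\<^sub>R h - z s" for s
  have \<nu>': "\<nu>' s \<in> normal_cone \<Theta> (z s)" for s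
    using closest_point_\<Theta>_iff z_def \<nu>'_def by metis
  have base: "closest_point \<Theta> (g y + \<nu>) = g y"
    using \<nu> by (simp add: closest_point_\<Theta>_iff)
  have proj: "closest_point (critical_cone \<Theta> (g y) \<nu>) h = g' y v"
    using closest_point_eq_iff_normal_cone[OF critical_cone_properties(2,1,3), of \<nu> h "g' y v"] n
    by (simp add: h_def)
  have spos: "\<forall>\<^sub>F s in at_right 0. 0 < (s::real)" by (rule eventually_at_right_less)
  have zq: "((\<lambda>s. (z s - g y) /\<^sub>R s) \<longlongrightarrow> g' y v) (at_right 0)"
    using PDC[of h] unfolding has_dir_derivative_def proj base z_def .
  have \<nu>q: "((\<lambda>s. (\<nu>' s - \<nu>) /\<^sub>R s) \<longlongrightarrow> n) (at_right 0)"
  proof -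
    have lim: "((\<lambda>s. h - (z s - g y) /\<^sub>R s) \<longlongrightarrow> h - g' y v) (at_right 0)"
      by (intro tendsto_intros zq)
    have "\<forall>\<^sub>F s in at_right 0. h - (z s - g y) /\<^sub>R s = (\<nu>' s - \<nu>) /\<^sub>R s"
      using spos by eventually_elim (simp add: \<nu>'_def algebra_simps)
    from Lim_transform_eventually[OF lim this] show ?thesis by (simp add: h_def)
  qed
  have zlim: "(z \<longlongrightarrow> g y) (at_right 0)"
    and \<eta>q: "((\<lambda>s. (\<eta> (z s) - \<eta> (g y)) /\<^sub>R s) \<longlongrightarrow> \<eta>' (g y) (g' y v)) (at_right 0)"
    using tendsto_difference_quotient[OF der_\<eta>[OF V(2)] tendsto_ident_at spos zq] by blast+
  have e: "((\<lambda>s. (\<eta> (z s) - F y) /\<^sub>R s) \<longlongrightarrow> F' y v) (at_right 0)"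
    using \<eta>q by (simp add: F_def F'_def)
  have eE: "\<forall>\<^sub>F s in at_right 0. \<eta> (z s) \<in> E"
    using topological_tendstoD[OF zlim V] by eventually_elim (use \<eta>E in blast)
  have contF: "continuous_on U F"
    using der_F by (meson continuous_at_imp_continuous_on has_derivative_continuous)
  have "\<exists>s x. 0 < s \<and> s < 1 / (real k + 1) \<and> x \<in> U \<and>
      norm (x - (y + s *\<^sub>R v)) \<le> 1 / (real k + 1) * s \<and> F x = \<eta> (z s)" for k :: nat
  proof -
    have k: "1 / (real k + 1) > 0" by simp
    have "\<forall>\<^sub>F s in at_right 0. s < 1 / (real k + 1)"
      using k by (intro eventually_at_right_real[of 0 "1 / (real k + 1)", THEN eventually_mono]) auto
    with solve_along_direction[OF der_F[OF U(2)] U contF F_range(1) E F_range(2) eE e k] spos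
    have "\<forall>\<^sub>F s in at_right 0. \<exists>x. 0 < s \<and> s < 1 / (real k + 1) \<and> x \<in> U \<and>
        norm (x - (y + s *\<^sub>R v)) \<le> 1 / (real k + 1) * s \<and> F x = \<eta> (z s)"
      by eventually_elim blast
    then show ?thesis by (rule eventually_happens'[rotated]) simp
  qed
  then obtain s x where s: "\<And>k. 0 < s k" "\<And>k::nat. s k < 1 / (real k + 1)"
    and x: "\<And>k. x k \<in> U" "\<And>k. norm (x k - (y + s k *\<^sub>R v)) \<le> 1 / (real k + 1) * s k"
      "\<And>k. F (x k) = \<eta> (z (s k))"
    by metis
  have inv0: "(\<lambda>k. 1 / (real k + 1)) \<longlonglongrightarrow> 0"
    using LIMSEQ_inverse_real_of_nat by (simp add: inverse_eq_divide add.commute)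
  have s0: "s \<longlonglongrightarrow> 0"
    by (rule Lim_null_comparison[OF always_eventually inv0]) (use s in \<open>simp add: less_imp_le\<close>)
  have spos': "\<forall>\<^sub>F k in sequentially. 0 < s k" using s(1) by simp
  have sR: "filterlim s (at_right 0) sequentially"
    unfolding filterlim_at using s0 s(1) by (auto simp: less_imp_neq[symmetric])
  have xq: "(\<lambda>k. (x k - y) /\<^sub>R s k) \<longlonglongrightarrow> v"
  proof (rule LIM_zero_cancel, rule Lim_null_comparison[OF always_eventually inv0], rule allI)
    fix k
    have "(x k - y) /\<^sub>R s k - v = (x k - (y + s k *\<^sub>R v)) /\<^sub>R s k"
      using s(1)[of k] by (simp add: algebra_simps)
    then have "norm ((x k - y) /\<^sub>R s k - v) = norm (x k - (y + s k *\<^sub>R v)) / s k"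
      using s(1)[of k] by (simp add: divide_inverse mult.commute)
    also have "\<dots> \<le> 1 / (real k + 1)"
      using x(2)[of k] s(1)[of k] by (simp add: pos_divide_le_eq)
    finally show "norm ((x k - y) /\<^sub>R s k - v) \<le> 1 / (real k + 1)" .
  qed
  have gq: "(\<lambda>k. (g (x k) - g y) /\<^sub>R s k) \<longlonglongrightarrow> g' y v"
    by (rule tendsto_difference_quotient(2)[OF der_g s0 spos' xq])
  have g'q: "(\<lambda>k. (g' (x k) - g' y) /\<^sub>R s k) \<longlonglongrightarrow> g'' v"
    by (rule tendsto_difference_quotient(2)[OF der_g' s0 spos' xq])
  have zq': "(\<lambda>k. (z (s k) - g y) /\<^sub>R s k) \<longlonglongrightarrow> g' y v"
    using filterlim_compose[OF zq sR] .
  have zlim': "(\<lambda>k. z (s k)) \<longlonglongrightarrow> g y"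
    using filterlim_compose[OF zlim sR] .
  have \<nu>q': "(\<lambda>k. (\<nu>' (s k) - \<nu>) /\<^sub>R s k) \<longlonglongrightarrow> n"
    using filterlim_compose[OF \<nu>q sR] .
  have \<nu>lim: "(\<lambda>k. \<nu>' (s k)) \<longlonglongrightarrow> \<nu>"
    by (rule tendsto_difference_quotient(1)[OF has_derivative_ident s0 spos' \<nu>q'])
  \<comment> \<open>The effect on the derivative of \<open>\<eta>\<close> of replacing \<open>z (s k)\<close> by \<open>g (x k)\<close>.\<close>
  define X where "X k = (\<eta>' (g (x k)) - \<eta>' (z (s k))) /\<^sub>R s k" for k
  have X: "X \<longlonglongrightarrow> 0"
    using tendsto_diff[OF tendsto_difference_quotient(2)[OF der_\<eta>' s0 spos' gq]
        tendsto_difference_quotient(2)[OF der_\<eta>' s0 spos' zq']]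
    by (simp add: X_def[abs_def] scaleR_diff_right)
  obtain M W where W: "M > 0" "open W" "g y \<in> W" "W \<subseteq> V"
    and W_normals: "\<forall>z\<in>W. (\<forall>\<mu>\<in>E. norm \<mu> \<le> M * norm (adjoint (\<eta>' z) \<mu>)) \<and>
      normal_cone \<Theta> z = adjoint (\<eta>' z) ` (E \<inter> normal_cone \<Xi> (\<eta> z))"
    using \<Theta>_normals by blast
  have zW: "\<forall>\<^sub>F k in sequentially. z (s k) \<in> W"
    using topological_tendstoD[OF zlim' W(2,3)] .
  have "\<forall>k. \<exists>\<mu>. z (s k) \<in> W \<longrightarrow>
      \<mu> \<in> E \<inter> normal_cone \<Xi> (\<eta> (z (s k))) \<and> \<nu>' (s k) = adjoint (\<eta>' (z (s k))) \<mu>"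
    using \<nu>' W_normals by blast
  then obtain \<mu> where \<mu>: "\<And>k. z (s k) \<in> W \<Longrightarrow> \<mu> k \<in> E \<inter> normal_cone \<Xi> (\<eta> (z (s k)))"
    "\<And>k. z (s k) \<in> W \<Longrightarrow> \<nu>' (s k) = adjoint (\<eta>' (z (s k))) (\<mu> k)"
    by metis
  have Xlim: "(\<lambda>k. adjoint (X k) (\<mu> k)) \<longlonglongrightarrow> 0"
  proof (rule Lim_null_comparison)
    show "\<forall>\<^sub>F k in sequentially. norm (adjoint (X k) (\<mu> k)) \<le> norm (X k) * (M * norm (\<nu>' (s k)))"
      using zW
    proof eventually_elim
      case (elim k)
      have "norm (\<mu> k) \<le> M * norm (\<nu>' (s k))"
        using bspec[OF W_normals elim] \<mu>[OF elim] by simp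
      then show ?case
        by (rule order_trans[OF norm_adjoint_le mult_left_mono]) simp
    qed
    have "(\<lambda>k. norm (X k) * (M * norm (\<nu>' (s k)))) \<longlonglongrightarrow> norm (0 :: 'b \<Rightarrow>\<^sub>L 'c) * (M * norm \<nu>)"
      by (intro tendsto_intros X \<nu>lim)
    then show "(\<lambda>k. norm (X k) * (M * norm (\<nu>' (s k)))) \<longlonglongrightarrow> 0" by simp
  qed
  define \<kappa> where "\<kappa> k = adjoint (\<eta>' (g (x k))) (\<mu> k)" for k
  have \<kappa>q: "(\<lambda>k. (\<kappa> k - \<nu>) /\<^sub>R s k) \<longlonglongrightarrow> n"
  proof -
    have lim: "(\<lambda>k. adjoint (X k) (\<mu> k) + (\<nu>' (s k) - \<nu>) /\<^sub>R s k) \<longlonglongrightarrow> n"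
      using tendsto_add[OF Xlim \<nu>q'] by simp
    have "\<forall>\<^sub>F k in sequentially.
        adjoint (X k) (\<mu> k) + (\<nu>' (s k) - \<nu>) /\<^sub>R s k = (\<kappa> k - \<nu>) /\<^sub>R s k"
      using zW by eventually_elim
        (simp add: \<mu>(2) X_def \<kappa>_def adjoint_blinfun_scaleR_left adjoint_blinfun_diff_left
          scaleR_diff_right)
    from Lim_transform_eventually[OF lim this] show ?thesis .
  qed
  define q where "q k = adjoint (g' (x k)) (\<kappa> k)" for k
  have qq: "(\<lambda>k. (q k - adjoint (g' y) \<nu>) /\<^sub>R s k) \<longlonglongrightarrow> adjoint (g'' v) \<nu> + adjoint (g' y) n"
    unfolding q_def by (rule tendsto_adjoint_difference_quotient[OF s0 spos' g'q \<kappa>q])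
  have q: "\<forall>\<^sub>F k in sequentially. q k \<in> regular_normal_cone \<Gamma> (x k)"
    using zW
  proof eventually_elim
    case (elim k)
    have \<mu>F: "\<mu> k \<in> normal_cone \<Xi> (F (x k))" using \<mu>(1)[OF elim] x(3)[of k] by simp
    have "x k \<in> \<Gamma>" using F_reduction[OF x(1)] normal_coneD(1)[OF \<mu>F] by simp
    from adjoint_normal_in_regular_normal_cone[OF der_F[OF x(1)] U(1) x(1) this _ \<mu>F]
    show ?case using F_reduction by (simp add: q_def \<kappa>_def adjoint_F')
  qed
  have pair: "(\<lambda>k. ((x k - y) /\<^sub>R s k, (q k - adjoint (g' y) \<nu>) /\<^sub>R s k))
      \<longlonglongrightarrow> (v, adjoint (g'' v) \<nu> + adjoint (g' y) n)"
    by (rule tendsto_Pair[OF xq qq])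
  show ?thesis
    unfolding graphical_derivative_def
  proof (rule CollectI, rule tangent_coneI_eventually[OF spos' s0 pair])
    show "\<forall>\<^sub>F k in sequentially. (y, adjoint (g' y) \<nu>)
        + s k *\<^sub>R ((x k - y) /\<^sub>R s k, (q k - adjoint (g' y) \<nu>) /\<^sub>R s k)
        \<in> {(x', y'). y' \<in> regular_normal_cone \<Gamma> x'}"
      using q by eventually_elim (use s(1) in \<open>simp add: less_imp_neq[symmetric]\<close>)
  qed
qed

end

section \<open>Jacobians and Hessians\<close>

lemma jacobian_mult_vec:
  fixes f :: "real^'m \<Rightarrow> real^'l"
  assumes "(f has_derivative f') (at x)"
  shows "jacobian f (at x) *v h = f' h"
proof -
  have "f differentiable (at x)" using assms by (rule differentiableI)
  then have "(f has_derivative (\<lambda>h. jacobian f (at x) *v h)) (at x)"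
    using jacobian_works by blast
  then show ?thesis using has_derivative_unique[OF assms] by metis
qed

lemma transpose_jacobian_mult_vec:
  fixes f' :: "(real^'m) \<Rightarrow>\<^sub>L (real^'l)"
  assumes "(f has_derivative f') (at x)"
  shows "transpose (jacobian f (at x)) *v \<nu> = adjoint f' \<nu>"
proof -
  have "blinfun_apply f' = (\<lambda>h. jacobian f (at x) *v h)"
    using jacobian_mult_vec[OF assms] by metis
  then show ?thesis by (simp add: adjoint_matrix)
qed

lemma bounded_linear_adjoint_left:
  "bounded_linear (\<lambda>A :: 'a::euclidean_space \<Rightarrow>\<^sub>L 'b::euclidean_space. adjoint A e)"
proof (rule bounded_linear_intro[where K = "norm e"])
  show "norm (adjoint A e) \<le> norm A * norm e" for A :: "'a \<Rightarrow>\<^sub>L 'b"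
    by (rule norm_adjoint_le)
qed (simp_all add: adjoint_blinfun_expansion blinfun.add_left blinfun.scaleR_left inner_add_left
    scaleR_add_left sum.distrib scaleR_sum_right)

lemma gradient_component:
  fixes g :: "real^'m \<Rightarrow> real^'l" and g' :: "(real^'m) \<Rightarrow>\<^sub>L (real^'l)"
  assumes "(g has_derivative g') (at x)"
  shows "gradient (\<lambda>y. g y $ i) x = adjoint g' (axis i 1)"
proof -
  have "((\<lambda>y. g y $ i) has_derivative (\<lambda>h. g' h $ i)) (at x)"
    by (rule bounded_linear.has_derivative[OF bounded_linear_vec_nth assms])
  then have fd: "frechet_derivative (\<lambda>y. g y $ i) (at x) = (\<lambda>h. g' h $ i)"
    by (rule frechet_derivative_at[symmetric])
  have "adjoint g' (axis i 1) $ j = g' (axis j 1) $ i" for j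
    using inner_adjoint_blinfun[of "axis j 1" g' "axis i 1"]
    by (simp add: inner_axis inner_axis')
  then show ?thesis by (simp add: gradient_def fd vec_eq_iff)
qed

text \<open>The Hessian of the Lagrangian term \<open>\<nu> \<bullet> g\<close> is the derivative of the map that sends \<open>x\<close> to
  \<open>adjoint (g' x) \<nu>\<close>, the gradient of \<open>\<nu> \<bullet> g\<close> at \<open>x\<close>.\<close>

lemma sum_hessian_mult_vec:
  fixes g :: "real^'m \<Rightarrow> real^'l" and g' :: "real^'m \<Rightarrow> (real^'m) \<Rightarrow>\<^sub>L (real^'l)"
  assumes der: "\<And>x. (g has_derivative g' x) (at x)" and der': "(g' has_derivative g'') (at y)"
  shows "(\<Sum>i\<in>UNIV. \<nu> $ i *\<^sub>R hessian (\<lambda>y. g y $ i) y) *v v = adjoint (g'' v) \<nu>"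
proof -
  have hess: "hessian (\<lambda>y. g y $ i) y *v v = adjoint (g'' v) (axis i 1)" for i
  proof -
    have "gradient (\<lambda>y. g y $ i) = (\<lambda>x. adjoint (g' x) (axis i 1))"
      using gradient_component[OF der] by blast
    then have "(gradient (\<lambda>y. g y $ i) has_derivative (\<lambda>h. adjoint (g'' h) (axis i 1))) (at y)"
      using bounded_linear.has_derivative[OF bounded_linear_adjoint_left der'] by simp
    then show ?thesis unfolding hessian_def by (rule jacobian_mult_vec)
  qed
  have "linear (\<lambda>A :: real^'m^'m. A *v v)"
    by (rule linearI) (simp_all add: matrix_vector_mult_add_rdistrib scaleR_matrix_vector_assoc)
  from linear_sum[OF this, of "\<lambda>i. \<nu> $ i *\<^sub>R hessian (\<lambda>y. g y $ i) y" UNIV]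
  have "(\<Sum>i\<in>UNIV. \<nu> $ i *\<^sub>R hessian (\<lambda>y. g y $ i) y) *v v
      = (\<Sum>i\<in>UNIV. \<nu> $ i *\<^sub>R adjoint (g'' v) (axis i 1))"
    by (simp add: scaleR_matrix_vector_assoc[symmetric] hess)
  also have "\<dots> = adjoint (g'' v) (\<Sum>i\<in>UNIV. \<nu> $ i *\<^sub>R axis i 1)"
    by (simp add: linear_sum[OF adjoint_linear[OF linear_blinfun_apply]] adjoint_blinfun_scaleR_right)
  also have "(\<Sum>i\<in>UNIV. \<nu> $ i *\<^sub>R axis i 1) = \<nu>"
    using basis_expansion[of \<nu>] by (simp add: scalar_mult_eq_scaleR)
  finally show ?thesis .
qed

section \<open>The second-order formula\<close>

lemma KKT_iff_normal_cone:
  fixes g' :: "(real^'m) \<Rightarrow>\<^sub>L (real^'l)"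
  assumes "convex_cone \<Theta>" and "g y \<in> \<Theta>" and "(g has_derivative g') (at y)"
  shows "KKT g \<Theta> y u \<nu> \<longleftrightarrow> \<nu> \<in> normal_cone \<Theta> (g y) \<and> u - y = adjoint g' \<nu>"
proof -
  have mem: "0 \<in> (\<lambda>n. - g y + n) ` N \<longleftrightarrow> g y \<in> N" for N
    by (auto simp: image_iff)
  have eq: "u = y + a \<longleftrightarrow> u - y = a" for a
    by (auto simp: algebra_simps)
  show ?thesis
    unfolding KKT_def transpose_jacobian_mult_vec[OF assms(3)] mem eq
      normal_cone_convex_cone_iff[OF assms(1,2)] by (rule conj_commute)
qed

text \<open>Pointedness of the reduced tangent cone forces the derivative of the reduction to vanish on the
  lineality space of \<open>tangent_cone \<Theta> (g y)\<close>, so by nondegeneracy composing with the derivative of \<open>g\<close>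
  does not shrink its range.\<close>

lemma range_reduction_derivative:
  fixes \<eta>' :: "(real^'l) \<Rightarrow>\<^sub>L (real^'q)" and g' :: "(real^'m) \<Rightarrow>\<^sub>L (real^'l)"
  assumes g: "(g has_derivative g') (at y)" and A2: "nondegenerate g \<Theta> y"
    and \<Theta>: "convex \<Theta>" "g y \<in> \<Theta>"
    and \<eta>: "(\<eta> has_derivative \<eta>') (at (g y))" and V: "open V" "g y \<in> V"
    and red: "\<And>z. z \<in> V \<Longrightarrow> z \<in> \<Theta> \<longleftrightarrow> \<eta> z \<in> \<Xi>"
    and ptd: "pointed (tangent_cone \<Xi> (\<eta> (g y)))"
  shows "range (\<eta>' o\<^sub>L g') = range \<eta>'"
proof
  have kernel: "\<eta>' b = 0" if b: "b \<in> lin (tangent_cone \<Theta> (g y))" for b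
  proof -
    have "b \<in> tangent_cone \<Theta> (g y)" "- b \<in> tangent_cone \<Theta> (g y)"
      using b unfolding lin_tangent_cone_convex[OF \<Theta>] by auto
    then have "\<eta>' b \<in> tangent_cone \<Xi> (\<eta> (g y))" "\<eta>' (- b) \<in> tangent_cone \<Xi> (\<eta> (g y))"
      using derivative_tangent_cone[OF \<eta> V, of \<Theta> \<Xi>] red by blast+
    then have "\<eta>' b \<in> tangent_cone \<Xi> (\<eta> (g y)) \<inter> uminus ` tangent_cone \<Xi> (\<eta> (g y))"
      by (auto simp: blinfun.minus_right image_iff intro!: bexI[of _ "- \<eta>' b"])
    then show ?thesis using ptd unfolding pointed_def by blast
  qed
  show "range \<eta>' \<subseteq> range (\<eta>' o\<^sub>L g')"
  proof clarify
    fix h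
    have "h \<in> {a + b | a b. a \<in> range (\<lambda>h. jacobian g (at y) *v h) \<and> b \<in> lin (tangent_cone \<Theta> (g y))}"
      using A2 unfolding nondegenerate_def by blast
    then obtain k b where "h = g' k + b" "b \<in> lin (tangent_cone \<Theta> (g y))"
      by (auto simp: jacobian_mult_vec[OF g])
    then have "\<eta>' h = (\<eta>' o\<^sub>L g') k" by (simp add: blinfun.add_right kernel)
    then show "\<eta>' h \<in> range (\<eta>' o\<^sub>L g')" by blast
  qed
qed auto

theorem theorem5p2:
  fixes g :: "real^'m \<Rightarrow> real^'l"
    and \<Theta> :: "(real^'l) set"
    and \<Gamma> :: "(real^'m) set"
    and E \<Xi> :: "(real^'q) set"
    and ybar wbar ubar :: "real^'m"
  assumes "C2_smooth_on UNIV g"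
    and "closed \<Theta>" and "convex_cone \<Theta>"
    and "\<Gamma> = g -` \<Theta>"
    and "ybar \<in> \<Gamma>"
    and A1: "C2_reducible_pointed \<Theta> (g ybar) E \<Xi>"
    and A2: "nondegenerate g \<Theta> ybar"
    and A3: "dir_differentiable (closest_point \<Theta>)"
    and "wbar \<in> regular_normal_cone \<Gamma> ybar"
    and "wbar = ubar - ybar"
    and "PDC \<Theta> (g ybar)"
  shows "(\<exists>!\<nu>. KKT g \<Theta> ybar ubar \<nu>) \<and>
    (\<forall>\<nu>. KKT g \<Theta> ybar ubar \<nu> \<longrightarrow>
      (\<forall>v. graphical_derivative (regular_normal_cone \<Gamma>) ybar wbar v =
        {(\<Sum>i\<in>UNIV. \<nu> $ i *\<^sub>R hessian (\<lambda>y. g y $ i) ybar) *v v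
           + transpose (jacobian g (at ybar)) *v n
         | n. n \<in> normal_cone (critical_cone \<Theta> (g ybar) \<nu>) (jacobian g (at ybar) *v v)}))"
proof -
  obtain g' g2 where g': "\<And>x. (g has_derivative blinfun_apply (g' x)) (at x)"
    and g2: "\<And>x. (g' has_derivative blinfun_apply (g2 x)) (at x)"
    using assms(1) unfolding C2_smooth_on_def by blast
  obtain V \<eta> where V: "g ybar \<in> V" and C2: "C2_smooth_on V \<eta>" and \<eta>E: "\<eta> ` V \<subseteq> E"
    and red: "\<And>x. x \<in> V \<Longrightarrow> x \<in> \<Theta> \<longleftrightarrow> \<eta> x \<in> \<Xi>"
    and ptd: "pointed (tangent_cone \<Xi> (\<eta> (g ybar)))"
    and rng: "range (\<lambda>h. jacobian \<eta> (at (g ybar)) *v h) = E"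
    and E: "subspace E" and \<Xi>: "\<Xi> \<subseteq> E" "convex \<Xi>"
    using A1 unfolding C2_reducible_pointed_def by blast
  obtain \<eta>' \<eta>2 where oV: "open V"
    and \<eta>': "\<And>z. z \<in> V \<Longrightarrow> (\<eta> has_derivative blinfun_apply (\<eta>' z)) (at z)"
    and \<eta>2: "\<And>z. z \<in> V \<Longrightarrow> (\<eta>' has_derivative blinfun_apply (\<eta>2 z)) (at z)"
    using C2 unfolding C2_smooth_on_def by blast
  have y: "g ybar \<in> \<Theta>" and \<Theta>: "convex \<Theta>"
    using assms(3-5) by (auto simp: convex_cone_def)
  have "range (\<eta>' (g ybar) o\<^sub>L g' ybar) = range (\<eta>' (g ybar))"
    by (rule range_reduction_derivative[OF g' A2 \<Theta> y \<eta>'[OF V] oV V red ptd])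
  also have "\<dots> = E"
    using rng by (simp add: jacobian_mult_vec[OF \<eta>'[OF V]])
  finally have surj: "range (\<eta>' (g ybar) o\<^sub>L g' ybar) = E" .
  interpret R: nondegenerate_reduction g g' "g2 ybar" ybar \<Theta> \<eta> \<eta>' "\<eta>2 (g ybar)" V E \<Xi>
    by unfold_locales (fact g' g2 assms(2) \<Theta> y oV V \<eta>' \<eta>2[OF V] \<eta>E E \<Xi> red surj)+
  have KKT: "KKT g \<Theta> ybar ubar \<nu> \<longleftrightarrow> \<nu> \<in> normal_cone \<Theta> (g ybar) \<and> wbar = adjoint (g' ybar) \<nu>" for \<nu>
    unfolding KKT_iff_normal_cone[OF assms(3) y g'] assms(10) by simp
  show ?thesis
  proof (intro conjI allI impI)
    show "\<exists>!\<nu>. KKT g \<Theta> ybar ubar \<nu>"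
      unfolding KKT using R.unique_multiplier assms(4,9) by blast
    fix \<nu> v assume "KKT g \<Theta> ybar ubar \<nu>"
    then have \<nu>: "\<nu> \<in> normal_cone \<Theta> (g ybar)" and w: "wbar = adjoint (g' ybar) \<nu>"
      unfolding KKT by auto
    have PDC: "has_dir_derivative (closest_point \<Theta>) (g ybar + \<nu>) h
        (closest_point (critical_cone \<Theta> (g ybar) \<nu>) h)" for h
      using assms(11) \<nu> unfolding PDC_def by blast
    have "graphical_derivative (regular_normal_cone \<Gamma>) ybar wbar v =
        {adjoint (g2 ybar v) \<nu> + adjoint (g' ybar) n
         | n. n \<in> normal_cone (critical_cone \<Theta> (g ybar) \<nu>) (g' ybar v)}"
      unfolding w assms(4)
      using R.graphical_derivative_subset[OF \<nu> PDC] R.graphical_derivative_superset[OF \<nu> PDC] by blast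
    then show "graphical_derivative (regular_normal_cone \<Gamma>) ybar wbar v =
        {(\<Sum>i\<in>UNIV. \<nu> $ i *\<^sub>R hessian (\<lambda>y. g y $ i) ybar) *v v
           + transpose (jacobian g (at ybar)) *v n
         | n. n \<in> normal_cone (critical_cone \<Theta> (g ybar) \<nu>) (jacobian g (at ybar) *v v)}"
      unfolding sum_hessian_mult_vec[OF g' g2] transpose_jacobian_mult_vec[OF g']
        jacobian_mult_vec[OF g'] .
  qed
qed

end
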